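(* Let $\Gamma$ be a complex hyperbolic triangle group of type $[m_1,m_2,m_3;n_1,n_2,n_3]$ with $m_1=m_2=m$, $m_3=0$, $n_1\le n_2$ and $n_3=2$, where $(n_1,n_2)$ is one of the pairs in the table below, and let $\alpha$ be its angular invariant. Then $\Gamma$ is discrete in $\mathrm{PU}(2,1)$ if \[\cosh(m/2)\ge\frac{1}{\sin(\pi/n_2)}\] and $|\cot(\alpha/2)|\le C$, where $C$ is given by \[\begin{array}{c|cccccc} (n_1,n_2) & (3,3) & (2,3) & (2,6) & (3,6) & (2,4) & (4,4)\\ \hline C & 1/\sqrt3 & 2\sqrt2-\sqrt3 & (4-\sqrt5)/\sqrt3 & 1/\sqrt3 & 1 & 2-\sqrt3 \end{array}\]
   Context: Let $\mathbb C^{2,1}$ be $\mathbb C^3$ with the Hermitian form $\langle z,w\rangle=z_1\bar w_1+z_2\bar w_2-z_3\bar w_3$. The complex hyperbolic plane $H^2_{\mathbb C}$ is the set of lines spanned by vectors $z$ with $\langle z,z\rangle<0$, and its boundary $\partial H^2_{\mathbb C}$ is the set of lines spanned by $z\ne0$ with $\langle z,z\rangle=0$. The distance $\rho$ (Bergman metric) is given by $\cosh^2(\rho([z],[w])/2)=\frac{\langle z,w\rangle\langle w,z\rangle}{\langle z,z\rangle\langle w,w\rangle}$. The group of holomorphic isometries is $\mathrm{PU}(2,1)$. A complex geodesic $C$ is the projectivisation of $\{z:\langle c,z\rangle=0\}$ for a vector $c$ with $\langle c,c\rangle>0$, called a polar vector of $C$ (unique up to scaling); $c$ is normalised if $\langle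 c,c\rangle=1$. Two complex geodesics $C,C'$ with normalised polar vectors $c,c'$ are ultra-parallel if they have no common point in $H^2_{\mathbb C}\cup\partial H^2_{\mathbb C}$, in which case $|\langle c,c'\rangle|=\cosh(\mathrm{dist}(C,C')/2)>1$; they are ideal if they have a common point in $\partial H^2_{\mathbb C}$ (and are disjoint in $H^2_{\mathbb C}$), in which case $|\langle c,c'\rangle|=1$ and $\mathrm{dist}(C,C')=0$. The minimal complex reflection of order $n$ in $C$ is the element of $\mathrm{PU}(2,1)$ of order $n$ with fixed point set $C$ induced by $z\mapsto -z+(1-\mu)\frac{\langle z,c\rangle}{\langle c,c\rangle}c$, where $\mu=\exp(2\pi i/n)$. An ultra-parallel $[m_1,m_2,m_3]$-triangle is a triple $(C_1,C_2,C_3)$ of complex geodesics, pairwise disjoint in $H^2_{\mathbb C}$, with $\mathrm{dist}(C_{k-1},C_{k+1})=m_k$ for $k=1,2,3$ (indices mod 3); $m_k=0$ is allowed and means that $C_{k-1},C_{k+1}$ are ideal. A complex hyperbolic (ultra-parallel) triangle group of type $[m_1,m_2,m_3;n_1,n_2,n_3]$ is the subgroup $\langle\iota_1,\iota_2,\iota_3\rangle$ of $\mathrm{PU}(2,1)$, where $\iota_k$ is the minimal complex reflection of order $n_k$ in $C_k$ and $(C_1,C_2,C_3)$ is an ultra-parallel $[m_1,m_2,m_3]$-triangle. Its angular invariant is $\alpha=\arg\left(\prod_{k=1}^3\langle c_{k-1},c_{k+1}\rangle\right)\in[0,2\pi]$, where $c_k$ is a normalised polar vector of $C_k$. *)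

theory Defs
  imports "HOL-Analysis.Analysis" "HOL-Algebra.Generated_Groups"
begin

section \<open>The complex hyperbolic plane\<close>

definition herm :: "complex^3 \<Rightarrow> complex^3 \<Rightarrow> complex" where
  "herm z w = z$1 * cnj (w$1) + z$2 * cnj (w$2) - z$3 * cnj (w$3)"

text \<open>The complex line spanned by \<open>z\<close>; here \<open>vec.span\<close> is the span over \<^typ>\<open>complex\<close>.
  Points of the projective plane are such lines with \<open>z \<noteq> 0\<close>.\<close>

definition line :: "complex^3 \<Rightarrow> (complex^3) set" where
  "line z = vec.span {z}"

text \<open>\<^term>\<open>herm z z\<close> is always real, see \<open>herm_self\<close> below.\<close>

definition complex_hyperbolic_plane :: "(complex^3) set set" where
  "complex_hyperbolic_plane = {line z | z. Re (herm z z) < 0}"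

definition boundary_plane :: "(complex^3) set set" where
  "boundary_plane = {line z | z. z \<noteq> 0 \<and> herm z z = 0}"

definition rho :: "(complex^3) set \<Rightarrow> (complex^3) set \<Rightarrow> real" where
  "rho P Q = (THE r. 0 \<le> r \<and> (\<forall>z w. line z = P \<longrightarrow> line w = Q \<longrightarrow>
     of_real ((cosh (r / 2))\<^sup>2) = herm z w * herm w z / (herm z z * herm w w)))"

section \<open>Complex geodesics\<close>

text \<open>A complex geodesic is taken as the full projectivisation of the orthogonal complement of
  its polar vector, so it also contains its boundary points (and points outside the closed
  ball); its points in the plane itself are obtained by intersecting.\<close>

definition geodesic_of :: "complex^3 \<Rightarrow> (complex^3) set set" where
  "geodesic_of c = {line z | z. z \<noteq> 0 \<and> herm c z = 0}"

definition polar_vector :: "complex^3 \<Rightarrow> (complex^3) set set \<Rightarrow> bool" where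
  "polar_vector c C \<longleftrightarrow> Re (herm c c) > 0 \<and> C = geodesic_of c"

definition complex_geodesic :: "(complex^3) set set \<Rightarrow> bool" where
  "complex_geodesic C \<longleftrightarrow> (\<exists>c. polar_vector c C)"

definition normalised_polar_vector :: "complex^3 \<Rightarrow> (complex^3) set set \<Rightarrow> bool" where
  "normalised_polar_vector c C \<longleftrightarrow> polar_vector c C \<and> herm c c = 1"

definition geodesic_dist :: "(complex^3) set set \<Rightarrow> (complex^3) set set \<Rightarrow> real" where
  "geodesic_dist C D = (INF (P, Q) \<in> (C \<inter> complex_hyperbolic_plane) \<times>
     (D \<inter> complex_hyperbolic_plane). rho P Q)"

definition disjoint_in_plane :: "(complex^3) set set \<Rightarrow> (complex^3) set set \<Rightarrow> bool" where
  "disjoint_in_plane C D \<longleftrightarrow> C \<inter> D \<inter> complex_hyperbolic_plane = {}"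

definition ideal_geodesics :: "(complex^3) set set \<Rightarrow> (complex^3) set set \<Rightarrow> bool" where
  "ideal_geodesics C D \<longleftrightarrow> disjoint_in_plane C D \<and> C \<inter> D \<inter> boundary_plane \<noteq> {}"

section \<open>The group PU(2,1)\<close>

definition U21 :: "(complex^3^3) monoid" where
  "U21 = \<lparr>carrier = {A. \<forall>z w. herm (A *v z) (A *v w) = herm z w}, mult = (**), one = mat 1\<rparr>"

definition scalars :: "(complex^3^3) set" where
  "scalars = {mat a | a. cmod a = 1}"

definition PU21 :: "(complex^3^3) set monoid" where
  "PU21 = U21 Mod scalars"

definition PU21_class :: "complex^3^3 \<Rightarrow> (complex^3^3) set" where
  "PU21_class A = scalars #>\<^bsub>U21\<^esub> A"

text \<open>The quotient topology of the subspace topology on U(2,1); see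
  \<open>quotient_map_PU21_class\<close> below.\<close>

definition PU21_topology :: "(complex^3^3) set topology" where
  "PU21_topology = topology (\<lambda>V. V \<subseteq> carrier PU21 \<and>
     openin (top_of_set (carrier U21)) {A \<in> carrier U21. PU21_class A \<in> V})"

definition discrete_subgroup_PU21 :: "(complex^3^3) set set \<Rightarrow> bool" where
  "discrete_subgroup_PU21 G \<longleftrightarrow>
     subgroup G PU21 \<and> subtopology PU21_topology G = discrete_topology G"

section \<open>Triangle groups\<close>

definition reflection_map :: "nat \<Rightarrow> complex^3 \<Rightarrow> complex^3 \<Rightarrow> complex^3" where
  "reflection_map n c z =
     - z + ((1 - exp (2 * of_real pi * \<i> / of_nat n)) * (herm z c / herm c c)) *s c"

text \<open>The choice of the polar vector is irrelevant, see \<open>minimal_reflection_eq\<close> below.\<close>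

definition minimal_reflection :: "nat \<Rightarrow> (complex^3) set set \<Rightarrow> (complex^3^3) set" where
  "minimal_reflection n C = PU21_class (matrix (reflection_map n (SOME c. polar_vector c C)))"

text \<open>Triples are indexed by the type \<^typ>\<open>3\<close>, whose arithmetic is modulo 3, so that
  \<open>k - 1\<close> and \<open>k + 1\<close> are the cyclic neighbours of \<open>k\<close>.\<close>

definition ultra_parallel_triangle :: "(3 \<Rightarrow> real) \<Rightarrow> (3 \<Rightarrow> (complex^3) set set) \<Rightarrow> bool" where
  "ultra_parallel_triangle m C \<longleftrightarrow>
     (\<forall>k. complex_geodesic (C k)) \<and>
     (\<forall>j k. j \<noteq> k \<longrightarrow> disjoint_in_plane (C j) (C k)) \<and>
     (\<forall>k. geodesic_dist (C (k - 1)) (C (k + 1)) = m k) \<and>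
     (\<forall>k. m k = 0 \<longrightarrow> ideal_geodesics (C (k - 1)) (C (k + 1)))"

definition triangle_group :: "(3 \<Rightarrow> nat) \<Rightarrow> (3 \<Rightarrow> (complex^3) set set) \<Rightarrow> (complex^3^3) set set" where
  "triangle_group n C = generate PU21 (range (\<lambda>k. minimal_reflection (n k) (C k)))"

text \<open>A relation because both \<open>0\<close> and \<open>2\<pi>\<close> are admitted as values. The product does not depend
  on the normalised polar vectors, see \<open>angular_product_eq\<close> below.\<close>

definition angular_invariant :: "(3 \<Rightarrow> (complex^3) set set) \<Rightarrow> real \<Rightarrow> bool" where
  "angular_invariant C \<alpha> \<longleftrightarrow> 0 \<le> \<alpha> \<and> \<alpha> \<le> 2 * pi \<and>
     (\<exists>c. (\<forall>k. normalised_polar_vector (c k) (C k)) \<and>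
          is_Arg (\<Prod>k\<in>UNIV. herm (c (k - 1)) (c (k + 1))) \<alpha>)"

section \<open>Well-definedness\<close>

lemma herm_add: "herm (x + y) z = herm x z + herm y z" "herm z (x + y) = herm z x + herm z y"
  and herm_diff: "herm (x - y) z = herm x z - herm y z" "herm z (x - y) = herm z x - herm z y"
  and herm_minus: "herm (- x) z = - herm x z" "herm z (- x) = - herm z x"
  and herm_scale: "herm (a *s x) z = a * herm x z" "herm z (a *s x) = cnj a * herm z x"
  by (simp_all add: herm_def algebra_simps)

lemma herm_cnj: "cnj (herm x y) = herm y x"
  by (simp add: herm_def algebra_simps)

lemma herm_self: "herm z z \<in> \<real>"
  by (metis Reals_cnj_iff herm_cnj)

lemma herm_nondegenerate: assumes "\<And>z. herm x z = 0" shows "x = 0"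
proof -
  have "herm x (axis k 1) = 0" for k using assms by blast
  from this[of 1] this[of 2] this[of 3] show ?thesis
    by (simp add: herm_def axis_def vec_eq_iff forall_3)
qed

lemma line_eq: "line z = {a *s z | a. True}"
  by (auto simp: line_def vec.span_singleton)

lemma geodesic_of_mem: assumes "z \<noteq> 0" shows "line z \<in> geodesic_of c \<longleftrightarrow> herm c z = 0"
proof
  assume "line z \<in> geodesic_of c"
  then obtain w where w: "line z = line w" "herm c w = 0" by (auto simp: geodesic_of_def)
  have "z \<in> line z" by (auto simp: line_eq intro: exI[of _ 1])
  then have "z \<in> line w" by (simp only: w(1))
  then show "herm c z = 0" using w(2) by (auto simp: line_eq herm_scale)
qed (use assms in \<open>auto simp: geodesic_of_def\<close>)

lemma polar_vector_unique:
  assumes c: "polar_vector c C" and d: "polar_vector d C"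
  obtains a where "a \<noteq> 0" "d = a *s c"
proof -
  define a where "a = herm d c / herm c c"
  have cc: "herm c c \<noteq> 0" "herm d d \<noteq> 0" using c d by (auto simp: polar_vector_def)
  have "herm (d - a *s c) x = 0" for x
  proof -
    define y where "y = x - (herm x c / herm c c) *s c"
    have "herm c y = 0"
      using cc by (simp add: y_def herm_diff herm_scale herm_cnj)
    then have "herm d y = 0"
      using geodesic_of_mem[of y c] geodesic_of_mem[of y d] c d
      by (cases "y = 0") (auto simp: polar_vector_def herm_def)
    then have "herm d x = herm c x / herm c c * herm d c"
      by (simp add: y_def herm_diff herm_scale herm_cnj)
    then show ?thesis by (simp add: a_def herm_diff herm_scale)
  qed
  then have "d = a *s c" using herm_nondegenerate by fastforce
  moreover from this have "a \<noteq> 0" using cc by (auto simp: herm_def)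
  ultimately show thesis using that by blast
qed

lemma minimal_reflection_eq:
  assumes "polar_vector c C"
  shows "minimal_reflection n C = PU21_class (matrix (reflection_map n c))"
proof -
  have "polar_vector (SOME c. polar_vector c C) C" using assms by (rule someI)
  then obtain a where a: "a \<noteq> 0" "(SOME c. polar_vector c C) = a *s c"
    using polar_vector_unique[OF assms] by blast
  have "reflection_map n (a *s c) = reflection_map n c"
    using a(1) by (simp add: fun_eq_iff reflection_map_def herm_scale)
  then show ?thesis by (simp add: minimal_reflection_def a(2))
qed

lemma angular_product_eq:
  fixes c d :: "3 \<Rightarrow> complex^3"
  assumes c: "\<And>k. normalised_polar_vector (c k) (C k)"
    and d: "\<And>k. normalised_polar_vector (d k) (C k)"
  shows "(\<Prod>k\<in>UNIV. herm (c (k - 1)) (c (k + 1))) = (\<Prod>k\<in>UNIV. herm (d (k - 1)) (d (k + 1)))"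
proof -
  have "\<exists>a. d k = a *s c k \<and> a * cnj a = 1" for k
  proof -
    have "polar_vector (c k) (C k)" "polar_vector (d k) (C k)"
      using c d by (auto simp: normalised_polar_vector_def)
    then obtain a where "d k = a *s c k" by (rule polar_vector_unique)
    moreover have "herm (d k) (d k) = 1" "herm (c k) (c k) = 1"
      using c[of k] d[of k] by (auto simp: normalised_polar_vector_def)
    ultimately have "d k = a *s c k \<and> a * cnj a = 1" by (simp add: herm_scale mult.commute)
    then show ?thesis by blast
  qed
  then obtain a where a: "\<And>k. d k = a k *s c k" "\<And>k. a k * cnj (a k) = 1" by metis
  have s: "(1::3) - 1 = 3" "(2::3) - 1 = 1" "(3::3) - 1 = 2"
    "(1::3) + 1 = 2" "(2::3) + 1 = 3" "(3::3) + 1 = 1" by simp_all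
  have P: "prod f UNIV = f 1 * f 2 * f 3" for f :: "3 \<Rightarrow> complex"
    unfolding UNIV_3 by (simp add: ac_simps)
  have "(\<Prod>k\<in>UNIV. herm (d (k - 1)) (d (k + 1))) =
    (a 1 * cnj (a 1)) * (a 2 * cnj (a 2)) * (a 3 * cnj (a 3)) *
    (\<Prod>k\<in>UNIV. herm (c (k - 1)) (c (k + 1)))"
    unfolding P s a(1) herm_scale by (simp only: ac_simps)
  then show ?thesis by (simp add: a(2))
qed

lemma U21_simps [simp]:
  "carrier U21 = {A. \<forall>z w. herm (A *v z) (A *v w) = herm z w}"
  "x \<otimes>\<^bsub>U21\<^esub> y = x ** y" "\<one>\<^bsub>U21\<^esub> = mat 1"
  by (simp_all add: U21_def)

lemma mat_vec [simp]: "mat a *v (z :: complex^3) = a *s z"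
  by (simp add: vec_eq_iff matrix_vector_mult_def mat_def if_distrib if_distribR sum.delta'
      cong: if_cong)

lemma group_U21: "group U21"
proof (rule groupI)
  fix A assume A: "A \<in> carrier U21"
  have "inj ((*v) A)"
  proof (rule injI)
    fix x y assume "A *v x = A *v y"
    then have "herm (A *v (x - y)) (A *v z) = 0" for z
      by (simp add: matrix_vector_mult_diff_distrib herm_def)
    then have "herm (x - y) z = 0" for z using A by simp
    then show "x = y" using herm_nondegenerate by fastforce
  qed
  then obtain B where B: "B ** A = mat 1" using matrix_left_invertible_injective by blast
  then have AB: "A ** B = mat 1" using matrix_left_right_inverse by blast
  have "herm (B *v z) (B *v w) = herm z w" for z w
  proof -
    have "herm (A *v (B *v z)) (A *v (B *v w)) = herm (B *v z) (B *v w)" using A by simp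
    then show ?thesis by (simp add: matrix_vector_mul_assoc AB)
  qed
  then show "\<exists>B\<in>carrier U21. B \<otimes>\<^bsub>U21\<^esub> A = \<one>\<^bsub>U21\<^esub>" using B by auto
qed (simp_all add: matrix_mul_assoc flip: matrix_vector_mul_assoc)

lemma mat_commute: "mat a ** A = A ** mat a" for A :: "complex^3^3"
  by (simp add: vec_eq_iff matrix_matrix_mult_def mat_def if_distrib if_distribR sum.delta
      sum.delta' mult.commute cong: if_cong)

lemma normal_scalars: "scalars \<lhd> U21"
proof -
  interpret group U21 by (rule group_U21)
  have mm: "mat a ** mat b = (mat (a * b) :: complex^3^3)" for a b
    by (simp add: matrix_eq flip: matrix_vector_mul_assoc)
  have one: "a * cnj a = 1" if "cmod a = 1" for a
    using that by (simp add: complex_norm_square[symmetric])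
  have sub: "scalars \<subseteq> carrier U21"
  proof
    fix A assume "A \<in> scalars"
    then obtain a where a: "A = mat a" "cmod a = 1" by (auto simp: scalars_def)
    have "herm (a *s z) (a *s w) = (a * cnj a) * herm z w" for z w by (simp add: herm_scale)
    then show "A \<in> carrier U21" by (simp add: a(1) one[OF a(2)])
  qed
  have "subgroup scalars U21"
  proof (rule subgroupI)
    show "scalars \<noteq> {}" by (auto simp: scalars_def intro: exI[of _ 1])
    fix A assume "A \<in> scalars"
    then obtain a where a: "A = mat a" "cmod a = 1" by (auto simp: scalars_def)
    have "inv\<^bsub>U21\<^esub> A = mat (cnj a)"
    proof (rule inv_equality)
      show "A \<in> carrier U21" using \<open>A \<in> scalars\<close> sub by blast
      have "mat (cnj a) \<in> scalars" using a by (auto simp: scalars_def)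
      then show "mat (cnj a) \<in> carrier U21" using sub by blast
    qed (use one[OF a(2)] in \<open>simp add: a mm mult.commute\<close>)
    then show "inv\<^bsub>U21\<^esub> A \<in> scalars" using a by (auto simp: scalars_def)
  next
    fix A B assume "A \<in> scalars" "B \<in> scalars"
    then obtain a b where "A = mat a" "cmod a = 1" "B = mat b" "cmod b = 1"
      by (auto simp: scalars_def)
    then have "A ** B = mat (a * b)" "cmod (a * b) = 1" by (simp_all add: mm norm_mult)
    then show "A \<otimes>\<^bsub>U21\<^esub> B \<in> scalars" unfolding U21_simps scalars_def by blast
  qed (rule sub)
  then show ?thesis
  proof (rule normalI, intro ballI)
    fix A
    have "h ** A = A ** h" if "h \<in> scalars" for h
      using that mat_commute by (auto simp: scalars_def)
    then show "scalars #>\<^bsub>U21\<^esub> A = A <#\<^bsub>U21\<^esub> scalars"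
      by (simp add: r_coset_def l_coset_def)
  qed
qed

lemma group_PU21: "group PU21"
  unfolding PU21_def by (rule normal.factorgroup_is_group[OF normal_scalars])

lemma carrier_PU21: "carrier PU21 = PU21_class ` carrier U21"
  by (simp add: PU21_def PU21_class_def carrier_FactGroup)

lemma openin_PU21_topology:
  "openin PU21_topology V \<longleftrightarrow> V \<subseteq> carrier PU21 \<and>
     openin (top_of_set (carrier U21)) {A \<in> carrier U21. PU21_class A \<in> V}"
proof -
  have I: "{A \<in> carrier U21. PU21_class A \<in> S \<inter> T} =
    {A \<in> carrier U21. PU21_class A \<in> S} \<inter> {A \<in> carrier U21. PU21_class A \<in> T}" for S T
    by blast
  have U: "{A \<in> carrier U21. PU21_class A \<in> \<Union>\<K>} =
    (\<Union>K\<in>\<K>. {A \<in> carrier U21. PU21_class A \<in> K})" for \<K> by blast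
  have "istopology (\<lambda>V. V \<subseteq> carrier PU21 \<and>
     openin (top_of_set (carrier U21)) {A \<in> carrier U21. PU21_class A \<in> V})"
    unfolding istopology_def I U by (intro conjI allI impI openin_Int openin_Union) blast+
  then show ?thesis unfolding PU21_topology_def by (simp only: topology_inverse')
qed

lemma quotient_map_PU21_class:
  "quotient_map (top_of_set (carrier U21)) PU21_topology PU21_class"
proof -
  have "{A \<in> carrier U21. PU21_class A \<in> carrier PU21} = carrier U21"
    by (auto simp: carrier_PU21)
  then have "openin PU21_topology (carrier PU21)"
    unfolding openin_PU21_topology by (simp only: openin_subtopology_self order_refl simp_thms)
  moreover have "V \<subseteq> carrier PU21" if "openin PU21_topology V" for V
    using that unfolding openin_PU21_topology by blast
  ultimately have "topspace PU21_topology = carrier PU21"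
    unfolding topspace_def by blast
  then show ?thesis
    unfolding quotient_map_def by (simp add: openin_PU21_topology carrier_PU21 del: U21_simps)
qed

lemma reflection_in_U21:
  assumes "Re (herm c c) > 0"
  shows "matrix (reflection_map n c) *v z = reflection_map n c z"
    and "matrix (reflection_map n c) \<in> carrier U21"
proof -
  have "Vector_Spaces.linear (*s) (*s) (reflection_map n c)"
    by unfold_locales
      (simp_all add: reflection_map_def herm_add herm_scale vec_eq_iff algebra_simps add_divide_distrib)
  then show *: "matrix (reflection_map n c) *v z = reflection_map n c z" for z
    by (simp add: matrix_works)
  define \<mu> where "\<mu> = exp (2 * of_real pi * \<i> / of_nat n)"
  have "\<mu> * cnj \<mu> = 1" by (simp add: \<mu>_def exp_cnj flip: exp_add)
  have r: "cnj (herm c c) = herm c c" "herm c c \<noteq> 0" using assms by (auto simp: herm_cnj)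
  have "herm (reflection_map n c z) (reflection_map n c w) = herm z w" for z w
  proof -
    have "herm (reflection_map n c z) (reflection_map n c w) = herm z w
      + (\<mu> * cnj \<mu> - 1) * (herm z c * herm c w / herm c c)"
      using r unfolding reflection_map_def \<mu>_def[symmetric]
      by (simp add: herm_add herm_diff herm_minus herm_scale herm_cnj field_simps)
    then show ?thesis by (simp add: \<open>\<mu> * cnj \<mu> = 1\<close>)
  qed
  then show "matrix (reflection_map n c) \<in> carrier U21" by (simp add: *)
qed

end

theory Submission
  imports Defs
begin

text \<open>The polar vectors of \<open>C\<^sub>1\<close> and \<open>C\<^sub>2\<close> can be scaled so that their difference \<open>p\<close> is a null
  vector fixed by \<open>\<iota>\<^sub>1\<close> and \<open>\<iota>\<^sub>2\<close>, so \<open>G = \<langle>\<iota>\<^sub>1, \<iota>\<^sub>2\<rangle>\<close> acts on the Heisenberg group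
  (the boundary without \<open>p\<close>) and, by vertical projection, as a discrete group of rotations and translations
  of the complex plane preserving a lattice of Eisenstein or Gaussian integers.
  The involution \<open>\<iota>\<^sub>3\<close> exchanges the two sides of its isometric sphere, a Cygan sphere of radius 1
  about \<open>q = \<iota>\<^sub>3 p\<close> in suitable coordinates. If every nontrivial element of \<open>G\<close> moves \<open>q\<close> by a Cygan
  distance of at least 2, then it maps the inside of this sphere into the outside, and a ping-pong
  argument shows that elements of \<open>\<Gamma>\<close> outside \<open>G\<close> move a suitable point of the plane by a definite
  amount, while nontrivial elements of \<open>G\<close> move \<open>q\<close> by a definite amount. The bounds on \<open>m\<close> and
  \<open>cot (\<alpha> / 2)\<close> are what is needed for the displacements: nontrivial elements of the planar group
  already move the projection of \<open>q\<close> by at least 2, and the remaining elements of \<open>G\<close> are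
  vertical translations by a distance that is large enough.\<close>

section \<open>Hermitian inequalities\<close>

text \<open>In the planar coordinate s, iota_1 and iota_2 rotate about -1 and 0. As m_1 = m_2, the
  projection s of q is equidistant from these centres: Re s = -1/2 and Im s = -cot(alpha/2)/2. So
  alpha fixes s, and m fixes the scale. A planar displacement w is large enough when 4 |s|^2 <=
  cosh(m/2)^2 |w|^2. For iota_2 itself |w| = 2 sin(pi/n_2) |s|, which gives the bound on m. With k =
  4 sin(pi/n_2)^2, equal to 3, 2 or 1, it then suffices for the other elements that k |s|^2 <=
  |w|^2, a condition on cot(alpha/2) alone. Long translations satisfy it by the triangle inequality,
  which leaves finitely many pairs of units to inspect. The awkward pair is (2,3): a lattice with
  all six Eisenstein units as rotations would contain rotations of order 6 about 0, which move q too
  little. A congruence modulo sqrt(-3) therefore ties the rotation to the translation. G itself is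
  never determined. The argument runs on an explicit set of Heisenberg isometries that contains
  lifts of the generators and is closed under left multiplication by them.\<close>

lemma cmod_herm_commute: "cmod (herm x y) = cmod (herm y x)"
  by (metis complex_mod_cnj herm_cnj)

lemma herm_self_Re: "herm z z = of_real (Re (herm z z))"
  using herm_self by (metis of_real_Re)

lemma herm_zero [simp]: "herm 0 z = 0" "herm z 0 = 0"
  by (simp_all add: herm_def)

lemma Re_herm_self:
  "Re (herm z z) = (cmod (z$1))\<^sup>2 + (cmod (z$2))\<^sup>2 - (cmod (z$3))\<^sup>2"
  unfolding herm_def by (simp flip: complex_norm_square of_real_power)

lemma cmod_sum_mult_le:
  fixes a b c d :: complex
  shows "(cmod (a * c + b * d))\<^sup>2 \<le> ((cmod a)\<^sup>2 + (cmod b)\<^sup>2) * ((cmod c)\<^sup>2 + (cmod d)\<^sup>2)"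
proof -
  have "cmod (a * c + b * d) \<le> cmod a * cmod c + cmod b * cmod d"
    using norm_triangle_ineq[of "a * c" "b * d"] by (simp add: norm_mult)
  then have "(cmod (a * c + b * d))\<^sup>2 \<le> (cmod a * cmod c + cmod b * cmod d)\<^sup>2"
    by (intro power_mono) auto
  also have "\<dots> \<le> ((cmod a)\<^sup>2 + (cmod b)\<^sup>2) * ((cmod c)\<^sup>2 + (cmod d)\<^sup>2)"
    using zero_le_power2[of "cmod a * cmod d - cmod b * cmod c"]
    by (simp add: power2_eq_square algebra_simps)
  finally show ?thesis .
qed

text \<open>The signature is (2,1), so a negative vector cannot be orthogonal to another nonzero
  vector of norm at most 0. The inequalities of this section apply this to well-chosen
  \<open>v\<close>.\<close>

lemma herm_orthogonal_nonneg:
  assumes "Re (herm z z) \<le> 0" "z \<noteq> 0" "herm v z = 0"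
  shows "0 \<le> Re (herm v v)"
proof -
  let ?Z = "(cmod (z$1))\<^sup>2 + (cmod (z$2))\<^sup>2" and ?V = "(cmod (v$1))\<^sup>2 + (cmod (v$2))\<^sup>2"
  have Z: "?Z \<le> (cmod (z$3))\<^sup>2" using assms(1) by (simp add: Re_herm_self)
  have z3: "z$3 \<noteq> 0"
  proof
    assume 0: "z$3 = 0"
    then have "z$1 = 0" "z$2 = 0" using Z by (simp_all add: sum_power2_le_zero_iff)
    with 0 assms(2) show False by (simp add: vec_eq_iff forall_3)
  qed
  have "v$3 * cnj (z$3) = v$1 * cnj (z$1) + v$2 * cnj (z$2)"
    using assms(3) by (simp add: herm_def)
  then have "(cmod (v$3) * cmod (z$3))\<^sup>2 \<le> ?V * ?Z"
    using cmod_sum_mult_le[of "v$1" "cnj (z$1)" "v$2" "cnj (z$2)"]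
    by (metis complex_mod_cnj norm_mult)
  also have "\<dots> \<le> ?V * (cmod (z$3))\<^sup>2" using Z by (intro mult_left_mono) auto
  finally have "(cmod (v$3))\<^sup>2 \<le> ?V" using z3 by (simp add: power_mult_distrib)
  then show ?thesis by (simp add: Re_herm_self)
qed

lemma herm_reversed_cauchy_schwarz:
  assumes "Re (herm z z) < 0"
  shows "Re (herm z z) * Re (herm w w) \<le> (cmod (herm z w))\<^sup>2"
proof -
  define N where "N = Re (herm z z)"
  define M where "M = Re (herm w w)"
  define v where "v = of_real N *s w - herm w z *s z"
  have zz: "herm z z = of_real N" "herm w w = of_real M" by (simp_all only: N_def M_def flip: herm_self_Re)
  have "z \<noteq> 0" using assms by auto
  have "herm v z = 0" by (simp add: v_def herm_diff herm_scale zz)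
  then have "0 \<le> Re (herm v v)" using assms \<open>z \<noteq> 0\<close> by (intro herm_orthogonal_nonneg) auto
  also have "herm v v = of_real (N * (N * M - (cmod (herm z w))\<^sup>2))"
    using complex_norm_square[of "herm z w"]
    by (simp add: v_def herm_diff herm_scale zz herm_cnj right_diff_distrib mult.commute)
  finally have "0 \<le> N * (N * M - (cmod (herm z w))\<^sup>2)" by simp
  then have "N * M - (cmod (herm z w))\<^sup>2 \<le> 0"
    using assms by (simp add: N_def zero_le_mult_iff)
  then show ?thesis by (simp add: N_def M_def)
qed

lemma unit_phase: obtains \<zeta> where "cmod \<zeta> = 1" "\<zeta> * of_real (cmod h) = h"
proof (cases "h = 0")
  case True then show thesis using that[of 1] by simp
next
  case False
  then show thesis by (intro that[of "sgn h"]) (simp_all add: norm_sgn, simp add: sgn_eq)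
qed

text \<open>The form is positive semidefinite on the complement of the null vector \<open>p\<close>.
  Evaluating it on \<open>x - \<zeta> *s y\<close>, with \<zeta> the phase of
  \<open>herm x y\<close>, gives the bound.\<close>

lemma herm_orthogonal_null_bound:
  assumes p: "herm p p = 0" "p \<noteq> 0" and x: "herm x p = 0" and y: "herm y p = 0"
  shows "2 * cmod (herm x y) \<le> Re (herm x x) + Re (herm y y)"
proof -
  obtain \<zeta> where \<zeta>: "cmod \<zeta> = 1" "\<zeta> * of_real (cmod (herm x y)) = herm x y"
    by (rule unit_phase)
  have 1: "\<zeta> * cnj \<zeta> = 1" using \<zeta>(1) by (simp flip: complex_norm_square)
  have h: "cnj \<zeta> * herm x y = of_real (cmod (herm x y))"
    using 1 by (subst \<zeta>(2)[symmetric]) (simp flip: mult.assoc add: mult.commute[of "cnj \<zeta>"])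
  then have h': "\<zeta> * herm y x = of_real (cmod (herm x y))"
    by (metis complex_cnj_cnj complex_cnj_complex_of_real complex_cnj_mult herm_cnj)
  define v where "v = x - \<zeta> *s y"
  have "0 \<le> Re (herm v v)"
    using p x y by (intro herm_orthogonal_nonneg[of p]) (auto simp: v_def herm_diff herm_scale)
  also have "herm v v = herm x x + (\<zeta> * cnj \<zeta>) * herm y y - (cnj \<zeta> * herm x y + \<zeta> * herm y x)"
    by (simp add: v_def herm_diff herm_scale algebra_simps)
  finally show ?thesis using h h' 1 by simp
qed

text \<open>Normalising \<open>\<langle>v,p\<rangle> = \<langle>a,p\<rangle> = \<langle>b,p\<rangle> = 1\<close>, this plays the role of the triangle inequality
  of the Cygan metric on the Heisenberg group.\<close>

lemma herm_null_triangle: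
  assumes p: "herm p p = 0" "p \<noteq> 0" and a: "herm a a = 0" "herm a p = 1"
    and b: "herm b b = 0" "herm b p = 1" and v: "herm v p = 1" "Re (herm v v) < 0"
  shows "cmod (herm a b) \<le> 2 * (cmod (herm v a) + cmod (herm v b))"
proof -
  define N where "N = - Re (herm v v)"
  have vv: "herm v v = - of_real N" using herm_self_Re[of v] by (simp add: N_def)
  \<comment> \<open>The differences are orthogonal to \<open>p\<close>, where the form is
    semidefinite. The products \<open>herm a b\<close>, \<open>herm v a\<close>,
    \<open>herm v b\<close> correspond to squared Cygan distances, hence the factor 2, as in (r +
    s)^2 <= 2 (r^2 + s^2).\<close>
  define x y where "x = a - v" and "y = b - v"
  have "herm x p = 0" "herm y p = 0" using a b v by (simp_all add: x_def y_def herm_diff)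
  then have "2 * cmod (herm x y) \<le> Re (herm x x) + Re (herm y y)"
    by (rule herm_orthogonal_null_bound[OF p])
  moreover have "Re (herm x x) = - 2 * Re (herm v a) - N" "Re (herm y y) = - 2 * Re (herm v b) - N"
    using herm_cnj[of v a] herm_cnj[of v b] a b
    by (auto simp: x_def y_def herm_diff N_def simp flip: herm_cnj[of v a] herm_cnj[of v b])
  moreover have "- Re (herm v a) \<le> cmod (herm v a)" "- Re (herm v b) \<le> cmod (herm v b)"
    using abs_Re_le_cmod[of "herm v a"] abs_Re_le_cmod[of "herm v b"] by linarith+
  ultimately have xy: "cmod (herm x y) \<le> cmod (herm v a) + cmod (herm v b) - N" by linarith
  have "herm a b = herm a v + herm v b + of_real N + herm x y"
    by (simp add: x_def y_def herm_diff vv)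
  then have "cmod (herm a b) \<le> cmod (herm a v) + cmod (herm v b) + \<bar>N\<bar> + cmod (herm x y)"
    by (metis (no_types, opaque_lifting) norm_of_real norm_triangle_mono order_refl)
  then show ?thesis using xy v(2) by (simp add: cmod_herm_commute[of a v] N_def)
qed

text \<open>The vector \<open>u\<close> is a multiple of the component of \<open>v\<close>
  orthogonal to \<open>p\<close> and \<open>q\<close>; it is orthogonal to the negative vector
  \<open>p - \<zeta> *s q\<close>, so its norm is nonnegative. Equality holds on the geodesic
  joining \<open>p\<close> and \<open>q\<close>.\<close>

lemma herm_null_product_bound:
  assumes p: "herm p p = 0" and q: "herm q q = 0" and v: "Re (herm v v) < 0"
  shows "- Re (herm v v) * cmod (herm p q) \<le> 2 * cmod (herm v p) * cmod (herm v q)"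
proof (cases "herm p q = 0")
  case False
  obtain \<zeta> where \<zeta>: "cmod \<zeta> = 1" "\<zeta> * of_real (cmod (herm p q)) = herm p q"
    by (rule unit_phase)
  define d where "d = cmod (herm p q)"
  have pq: "herm p q = \<zeta> * of_real d" "herm q p = cnj \<zeta> * of_real d"
    using \<zeta>(2) by (auto simp: d_def) (metis \<zeta>(2) complex_cnj_complex_of_real complex_cnj_mult herm_cnj)
  have 1: "\<zeta> * cnj \<zeta> = 1" using \<zeta>(1) by (simp flip: complex_norm_square)
  have d: "d > 0" using False by (simp add: d_def)
  have 2: "\<zeta> * a * (cnj \<zeta> * b) = a * b" "cnj \<zeta> * a * (\<zeta> * b) = a * b" for a b
  proof -
    have "\<zeta> * a * (cnj \<zeta> * b) = (\<zeta> * cnj \<zeta>) * (a * b)"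
      "cnj \<zeta> * a * (\<zeta> * b) = (\<zeta> * cnj \<zeta>) * (a * b)" by (simp_all only: ac_simps)
    then show "\<zeta> * a * (cnj \<zeta> * b) = a * b" "cnj \<zeta> * a * (\<zeta> * b) = a * b"
      using 1 by simp_all
  qed
  define u where "u = of_real d *s v - (cnj \<zeta> * herm v q) *s p - (\<zeta> * herm v p) *s q"
  have u: "herm u p = 0" "herm u q = 0"
    by (simp_all add: u_def herm_diff herm_scale p q pq 2)
  have n: "p - \<zeta> *s q \<noteq> 0"
  proof
    assume "p - \<zeta> *s q = 0"
    then have "p = \<zeta> *s q" by simp
    then have "herm p q = \<zeta> * herm q q" by (simp add: herm_scale)
    then show False using q False by simp
  qed
  have "herm (p - \<zeta> *s q) (p - \<zeta> *s q) = of_real (- 2 * d)"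
    using 1 by (simp add: herm_diff herm_scale p q pq mult.commute[of "cnj \<zeta>" \<zeta>] flip: mult.assoc)
  moreover have "herm u (p - \<zeta> *s q) = 0"
    by (simp add: herm_diff herm_scale u)
  ultimately have "0 \<le> Re (herm u u)" using d n
    by (intro herm_orthogonal_nonneg[of "p - \<zeta> *s q"]) auto
  also have "herm u u = of_real d * herm u v"
    by (subst (2) u_def) (simp add: herm_diff herm_scale u)
  also have "herm u v = of_real d * herm v v - (cnj (\<zeta> * herm v p * herm q v) + \<zeta> * herm v p * herm q v)"
    by (simp add: u_def herm_diff herm_scale herm_cnj)
  also have "Re (of_real d * (of_real d * herm v v - (cnj (\<zeta> * herm v p * herm q v) + \<zeta> * herm v p * herm q v)))
    = d * (d * Re (herm v v) - 2 * Re (\<zeta> * herm v p * herm q v))"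
    by (simp add: algebra_simps)
  finally have "2 * Re (\<zeta> * herm v p * herm q v) \<le> d * Re (herm v v)"
    using d by (simp add: zero_le_mult_iff)
  moreover have "\<bar>Re (\<zeta> * herm v p * herm q v)\<bar> \<le> cmod (herm v p) * cmod (herm v q)"
    using abs_Re_le_cmod[of "\<zeta> * herm v p * herm q v"] \<zeta>(1)
    by (simp add: norm_mult cmod_herm_commute[of q v])
  ultimately have "- (d * Re (herm v v)) \<le> 2 * (cmod (herm v p) * cmod (herm v q))" by linarith
  then show ?thesis by (simp add: d_def mult_ac)
qed (simp)

section \<open>The distance of complex geodesics\<close>

lemma line_self: "z \<in> line z"
  by (auto simp: line_eq intro: exI[of _ 1])

lemma line_eq_imp:
  assumes "line z = line w" "w \<noteq> 0"
  obtains a where "a \<noteq> 0" "z = a *s w"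
proof -
  obtain a where a: "z = a *s w" using line_self[of z] assms(1) by (auto simp: line_eq)
  obtain b where "w = b *s z" using line_self[of w] assms(1) by (auto simp: line_eq)
  then have "a \<noteq> 0" using a assms(2) by auto
  then show thesis using a that by blast
qed

text \<open>The definite description in \<open>rho\<close> is legitimate because the quotient is
  independent of the representatives, is at least 1, and cosh is injective on nonnegative
  reals.\<close>

lemma rho_line:
  assumes z: "Re (herm z z) < 0" and w: "Re (herm w w) < 0"
  shows "0 \<le> rho (line z) (line w)"
    and "(cosh (rho (line z) (line w) / 2))\<^sup>2 =
      (cmod (herm z w))\<^sup>2 / (Re (herm z z) * Re (herm w w))"
proof -
  define M N where "M = Re (herm z z)" and "N = Re (herm w w)"
  have zz: "herm z z = of_real M" "herm w w = of_real N"
    by (simp_all only: M_def N_def flip: herm_self_Re)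
  have MN: "M < 0" "N < 0" using assms by (simp_all add: M_def N_def)
  define k where "k = (cmod (herm z w))\<^sup>2 / (M * N)"
  have "1 \<le> k"
    using herm_reversed_cauchy_schwarz[OF z, of w] MN
    by (simp add: k_def M_def N_def mult_neg_neg)
  have nz: "z \<noteq> 0" "w \<noteq> 0" using assms by auto
  have k: "herm z w * herm w z = of_real (k * M * N)"
    using MN complex_norm_square[of "herm z w"] by (simp add: k_def herm_cnj)
  let ?P = "\<lambda>r. 0 \<le> r \<and> (\<forall>z' w'. line z' = line z \<longrightarrow> line w' = line w \<longrightarrow>
     of_real ((cosh (r / 2))\<^sup>2) = herm z' w' * herm w' z' / (herm z' z' * herm w' w'))"
  have P: "?P r \<longleftrightarrow> 0 \<le> r \<and> (cosh (r / 2))\<^sup>2 = k" for r :: real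
  proof -
    have *: "herm z' w' * herm w' z' / (herm z' z' * herm w' w') = of_real k"
      if lines: "line z' = line z" "line w' = line w" for z' w'
    proof -
      obtain a b where ab: "a \<noteq> 0" "b \<noteq> 0" "z' = a *s z" "w' = b *s w"
        using line_eq_imp[OF lines(1) nz(1)] line_eq_imp[OF lines(2) nz(2)] by metis
      have "herm z' w' * herm w' z' = (a * cnj a * b * cnj b) * (herm z w * herm w z)"
        "herm z' z' * herm w' w' = (a * cnj a * b * cnj b) * (of_real (M * N))"
        by (simp_all add: ab herm_scale zz)
      then show ?thesis using ab MN by (simp add: k)
    qed
    show ?thesis using * by (metis of_real_eq_iff)
  qed
  define r0 where "r0 = 2 * arcosh (sqrt k)"
  have r0: "?P r0" unfolding P
    using \<open>1 \<le> k\<close> by (simp add: r0_def)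
  have "r = r0" if "?P r" for r
  proof -
    have "(cosh (r / 2))\<^sup>2 = (cosh (r0 / 2))\<^sup>2" "0 \<le> r" "0 \<le> r0" using that r0 unfolding P by auto
    then have "cosh (r / 2) = cosh (r0 / 2)"
      by (metis cosh_real_nonneg power2_eq_iff_nonneg)
    then show ?thesis using \<open>0 \<le> r\<close> \<open>0 \<le> r0\<close>
      by (metis cosh_real_nonneg_less_iff divide_nonneg_pos divide_strict_right_mono less_irrefl
          linorder_neqE_linordered_idom zero_less_numeral)
  qed
  with r0 have "rho (line z) (line w) = r0" unfolding rho_def by (intro the_equality)
  then show "0 \<le> rho (line z) (line w)" "(cosh (rho (line z) (line w) / 2))\<^sup>2 =
      (cmod (herm z w))\<^sup>2 / (Re (herm z z) * Re (herm w w))"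
    using r0 unfolding P by (simp_all add: k_def M_def N_def)
qed

lemma geodesic_of_Int_plane:
  "geodesic_of c \<inter> complex_hyperbolic_plane = {line z | z. herm c z = 0 \<and> Re (herm z z) < 0}"
proof (intro equalityI subsetI)
  fix P assume "P \<in> geodesic_of c \<inter> complex_hyperbolic_plane"
  then obtain z where z: "P = line z" "Re (herm z z) < 0" "line z \<in> geodesic_of c"
    by (auto simp: complex_hyperbolic_plane_def)
  moreover have "z \<noteq> 0" using z by auto
  ultimately show "P \<in> {line z | z. herm c z = 0 \<and> Re (herm z z) < 0}"
    using geodesic_of_mem by blast
next
  fix P assume "P \<in> {line z | z. herm c z = 0 \<and> Re (herm z z) < 0}"
  then show "P \<in> geodesic_of c \<inter> complex_hyperbolic_plane"
    by (auto simp: complex_hyperbolic_plane_def) (metis geodesic_of_mem herm_zero(1) less_irrefl zero_complex.simps(1))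
qed

lemma disjoint_in_plane_geodesic_of:
  "disjoint_in_plane (geodesic_of c) (geodesic_of d) \<longleftrightarrow>
     (\<forall>z. herm c z = 0 \<longrightarrow> herm d z = 0 \<longrightarrow> 0 \<le> Re (herm z z))"
proof -
  have "geodesic_of c \<inter> geodesic_of d \<inter> complex_hyperbolic_plane = {} \<longleftrightarrow>
    (\<forall>z. line z \<in> geodesic_of c \<inter> complex_hyperbolic_plane \<longrightarrow> line z \<notin> geodesic_of d)"
    by (auto simp: complex_hyperbolic_plane_def)
  also have "\<dots> \<longleftrightarrow> (\<forall>z. herm c z = 0 \<longrightarrow> herm d z = 0 \<longrightarrow> 0 \<le> Re (herm z z))"
  proof -
    have "line z \<in> complex_hyperbolic_plane \<longleftrightarrow> Re (herm z z) < 0" for z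
    proof
      assume "line z \<in> complex_hyperbolic_plane"
      then obtain w where w: "line z = line w" "Re (herm w w) < 0"
        by (auto simp: complex_hyperbolic_plane_def)
      then have "w \<noteq> 0" by auto
      then obtain a where a: "a \<noteq> 0" "z = a *s w" using line_eq_imp w(1) by blast
      have "herm z z = of_real ((cmod a)\<^sup>2) * herm w w"
        unfolding complex_norm_square by (simp add: a herm_scale)
      then show "Re (herm z z) < 0" using w(2) a(1) by (simp add: mult_pos_neg)
    qed (auto simp: complex_hyperbolic_plane_def)
    moreover have "line z \<in> geodesic_of e \<longleftrightarrow> herm e z = 0" if "Re (herm z z) < 0" for z e
      using that by (intro geodesic_of_mem) auto
    ultimately show ?thesis by (auto simp flip: not_less)
  qed
  finally show ?thesis by (simp add: disjoint_in_plane_def)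
qed

text \<open>If the modulus were below 1, \<open>c\<close> and \<open>d\<close> would span a positive
  definite plane. Removing from a negative vector its components along the orthogonal basis
  \<open>c\<close>, \<open>d'\<close> keeps it negative and puts it on both geodesics.\<close>

lemma disjoint_imp_cmod_herm_ge_1:
  assumes c: "herm c c = 1" and d: "herm d d = 1"
    and disj: "disjoint_in_plane (geodesic_of c) (geodesic_of d)"
  shows "1 \<le> cmod (herm c d)"
proof (rule ccontr)
  assume "\<not> ?thesis"
  then have k: "(cmod (herm c d))\<^sup>2 < 1" by (simp add: abs_square_less_1)
  define K where "K = 1 - (cmod (herm c d))\<^sup>2"
  have K: "K > 0" "herm d c * herm c d = 1 - of_real K"
    using k complex_norm_square[of "herm c d"] by (simp_all add: K_def herm_cnj mult.commute)
  define v :: "complex^3" where "v = axis 3 1"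
  have v: "herm v v = - 1" by (simp add: herm_def v_def axis_def)
  define d' where "d' = d - herm d c *s c"
  have d': "herm d' d' = of_real K" "herm d' c = 0" "herm c d' = 0" "herm d' d = of_real K"
    using c d K by (simp_all add: d'_def herm_diff herm_scale herm_cnj mult.commute)
  define z where "z = v - herm v c *s c - (herm v d' / of_real K) *s d'"
  have zc: "herm z c = 0" "herm z d' = 0"
    using c d' K by (simp_all add: z_def herm_diff herm_scale)
  then have zd: "herm z d = 0"
    by (simp add: d'_def herm_diff herm_scale)
  have "herm z z = herm z v"
    using zc by (subst (2) z_def) (simp add: herm_diff herm_scale)
  also have "\<dots> = - of_real (1 + (cmod (herm v c))\<^sup>2 + (cmod (herm v d'))\<^sup>2 / K)"
    using complex_norm_square[of "herm v c"] complex_norm_square[of "herm v d'"]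
    by (simp add: z_def herm_diff herm_scale v herm_cnj)
  finally have "Re (herm z z) = - (1 + (cmod (herm v c))\<^sup>2 + (cmod (herm v d'))\<^sup>2 / K)" by simp
  moreover have "0 \<le> (cmod (herm v c))\<^sup>2 + (cmod (herm v d'))\<^sup>2 / K" using K by simp
  ultimately have "Re (herm z z) < 0" by linarith
  moreover have "herm c z = 0" "herm d z = 0"
    using zc zd herm_cnj[of z c] herm_cnj[of z d] by auto
  ultimately show False using disj unfolding disjoint_in_plane_geodesic_of by force
qed

text \<open>This is the lower bound for the distance. The reversed Cauchy-Schwarz inequality is used
  twice: for \<open>w\<close> and the part \<open>e\<close> of \<open>c\<close> orthogonal to
  \<open>d\<close>, then for \<open>z\<close> and the part \<open>w'\<close> of \<open>w\<close>
  orthogonal to \<open>c\<close>.\<close>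

lemma herm_orthogonal_product_bound:
  assumes c: "herm c c = 1" and d: "herm d d = 1" and k: "1 \<le> cmod (herm c d)"
    and z: "herm c z = 0" "Re (herm z z) < 0" and w: "herm d w = 0" "Re (herm w w) < 0"
  shows "(cmod (herm c d))\<^sup>2 * (Re (herm z z) * Re (herm w w)) \<le> (cmod (herm z w))\<^sup>2"
proof -
  define k where "k = (cmod (herm c d))\<^sup>2"
  have hk: "herm c d * herm d c = of_real k"
    using complex_norm_square[of "herm c d"] by (simp add: k_def herm_cnj)
  have zc: "herm z c = 0" "herm w d = 0"
    using z w herm_cnj[of c z] herm_cnj[of d w] by auto
  define e where "e = c - herm c d *s d"
  have "herm w e = herm w c" by (simp add: e_def herm_diff herm_scale zc)
  moreover have "Re (herm e e) = 1 - k"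
    using hk by (simp add: e_def herm_diff herm_scale c d herm_cnj mult.commute)
  ultimately have 1: "Re (herm w w) * (1 - k) \<le> (cmod (herm w c))\<^sup>2"
    using herm_reversed_cauchy_schwarz[OF w(2), of e] by simp
  define w' where "w' = w - herm w c *s c"
  have "herm z w' = herm z w" by (simp add: w'_def herm_diff herm_scale zc)
  moreover have "Re (herm w' w') = Re (herm w w) - (cmod (herm w c))\<^sup>2"
  proof -
    have "herm w' w' = herm w w - of_real ((cmod (herm w c))\<^sup>2)"
      unfolding complex_norm_square by (simp add: w'_def herm_diff herm_scale c herm_cnj)
    then show ?thesis by simp
  qed
  ultimately have 2: "Re (herm z z) * (Re (herm w w) - (cmod (herm w c))\<^sup>2) \<le> (cmod (herm z w))\<^sup>2"
    using herm_reversed_cauchy_schwarz[OF z(2), of w'] by simp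
  have "k * Re (herm w w) \<ge> Re (herm w w) - (cmod (herm w c))\<^sup>2" using 1 by (simp add: algebra_simps)
  then have "Re (herm z z) * (k * Re (herm w w)) \<le> Re (herm z z) * (Re (herm w w) - (cmod (herm w c))\<^sup>2)"
    using z(2) by (intro mult_left_mono_neg) auto
  with 2 show ?thesis by (simp add: k_def mult_ac)
qed

text \<open>The point \<open>w\<close> is the foot of the perpendicular from \<open>z\<close> to the
  geodesic polar to \<open>d\<close>; the last formula is cosh^2 of half their distance.\<close>

lemma projection_distance:
  assumes d: "herm d d = 1" and z: "Re (herm z z) < 0"
  defines "w \<equiv> z - herm z d *s d"
  shows "herm d w = 0" "Re (herm w w) < 0"
    "(cmod (herm z w))\<^sup>2 / (Re (herm z z) * Re (herm w w))
      = 1 + (cmod (herm z d))\<^sup>2 / (- Re (herm z z))"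
proof -
  define M h where "M = - Re (herm z z)" and "h = (cmod (herm z d))\<^sup>2"
  have M: "herm z z = - of_real M" "M > 0"
    using herm_self_Re[of z] z by (simp_all add: M_def)
  have h: "herm z d * herm d z = of_real h" "h \<ge> 0"
    using complex_norm_square[of "herm z d"] by (simp_all add: h_def herm_cnj)
  show "herm d w = 0" by (simp add: w_def herm_diff herm_scale d herm_cnj)
  have zw: "herm z w = - of_real (M + h)" "herm w w = - of_real (M + h)"
    using h by (simp_all add: w_def herm_diff herm_scale d herm_cnj M mult.commute)
  show "Re (herm w w) < 0" using M h by (simp add: zw)
  have "cmod (herm z w) = M + h" using M h by (simp add: zw del: of_real_add)
  then have "(cmod (herm z w))\<^sup>2 / (Re (herm z z) * Re (herm w w)) = (M + h)\<^sup>2 / (M * (M + h))"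
    by (simp add: M zw(2) del: minus_add_distrib of_real_add)
  also have "\<dots> = 1 + h / M" using M h by (simp add: power2_eq_square add_divide_distrib)
  finally show "(cmod (herm z w))\<^sup>2 / (Re (herm z z) * Re (herm w w))
      = 1 + (cmod (herm z d))\<^sup>2 / (- Re (herm z z))" by (simp add: M_def h_def)
qed

lemma exists_negative_orthogonal:
  assumes "herm c c = 1" obtains z where "herm c z = 0" "Re (herm z z) < 0"
proof -
  define v :: "complex^3" where "v = axis 3 1"
  have v: "herm v v = - 1" by (simp add: herm_def v_def axis_def)
  show thesis
  proof (rule that[of "v - herm v c *s c"])
    show "herm c (v - herm v c *s c) = 0" by (simp add: herm_diff herm_scale assms herm_cnj)
    have "herm (v - herm v c *s c) (v - herm v c *s c) = - of_real (1 + (cmod (herm v c))\<^sup>2)"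
      using complex_norm_square[of "herm v c"]
      by (simp add: herm_diff herm_scale assms v herm_cnj)
    then have "Re (herm (v - herm v c *s c) (v - herm v c *s c)) = - (1 + (cmod (herm v c))\<^sup>2)"
      by simp
    then show "Re (herm (v - herm v c *s c) (v - herm v c *s c)) < 0"
      by (smt (verit) zero_le_power2)
  qed
qed

text \<open>Ultra-parallel geodesics have a common perpendicular, and its foot attains the minimum.
  For ideal geodesics the infimum is only approached, by points tending to the common boundary
  point, hence the slack \<open>t\<close>.\<close>

lemma near_minimal_points:
  assumes c: "herm c c = 1" and d: "herm d d = 1" and k: "1 \<le> cmod (herm c d)" and t: "t > 0"
  obtains z where "herm c z = 0" "Re (herm z z) < 0"
    "(cmod (herm z d))\<^sup>2 / (- Re (herm z z)) \<le> (cmod (herm c d))\<^sup>2 - 1 + t"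
proof (cases "cmod (herm c d) = 1")
  case False
  define k where "k = (cmod (herm c d))\<^sup>2 - 1"
  have k: "k > 0" using False k by (simp add: k_def)
  have hk: "herm d c * herm c d = of_real (1 + k)"
    using complex_norm_square[of "herm c d"] by (simp add: k_def herm_cnj mult.commute)
  define z where "z = d - herm d c *s c"
  have "herm c z = 0" by (simp add: z_def herm_diff herm_scale c herm_cnj)
  moreover have zd: "herm z d = - of_real k" "herm z z = - of_real k"
    using hk by (simp_all add: z_def herm_diff herm_scale c d herm_cnj mult.commute)
  moreover have "(cmod (herm z d))\<^sup>2 / (- Re (herm z z)) = k"
    using k by (simp add: zd power2_eq_square)
  ultimately show thesis using that[of z] k t by (simp add: k_def)
next
  case True
  have hk: "herm d c * herm c d = 1"
    using complex_norm_square[of "herm c d"] True by (simp add: herm_cnj mult.commute)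
  obtain z where z: "herm c z = 0" "Re (herm z z) < 0"
    using exists_negative_orthogonal[OF c] .
  have zc: "herm z c = 0" using z(1) herm_cnj[of c z] by simp
  define p where "p = d - herm d c *s c"
  define \<xi> where "\<xi> = herm z d"
  have p: "herm c p = 0" "herm p d = 0" "herm p p = 0" "herm z p = \<xi>" "herm p z = cnj \<xi>"
    using hk zc z(1) by (simp_all add: p_def herm_diff herm_scale c d herm_cnj \<xi>_def mult.commute)
  \<comment> \<open>Moving along \<open>p\<close> leaves \<open>herm y d\<close> equal to \<xi> and
    makes the norm of \<open>y\<close> at most -2 s |xi|^2, so the quotient is at most 1/(2s); this
    is \<open>t\<close>.\<close>
  define s where "s = 1 / (2 * t)"
  have s: "s > 0" using t by (simp add: s_def)
  define y where "y = z - (of_real s * \<xi>) *s p"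
  have "herm c y = 0" by (simp add: y_def herm_diff herm_scale z p)
  moreover have yd: "herm y d = \<xi>" by (simp add: y_def herm_diff herm_scale p \<xi>_def)
  moreover have yy: "Re (herm y y) = Re (herm z z) - 2 * s * (cmod \<xi>)\<^sup>2"
  proof -
    have "herm y y = herm z z - of_real (2 * s * (cmod \<xi>)\<^sup>2)"
      using complex_norm_square[of \<xi>]
      by (simp add: y_def herm_diff herm_scale p mult.commute)
    then show ?thesis by simp
  qed
  moreover have "0 \<le> 2 * s * (cmod \<xi>)\<^sup>2" using s by simp
  ultimately have "Re (herm y y) < 0" using z by linarith
  moreover have "(cmod \<xi>)\<^sup>2 / (- Re (herm y y)) \<le> t"
  proof -
    have "(cmod \<xi>)\<^sup>2 = t * (2 * s * (cmod \<xi>)\<^sup>2)" using t by (simp add: s_def)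
    also have "\<dots> \<le> t * (- Re (herm y y))" using z t by (intro mult_left_mono) (auto simp: yy)
    finally show ?thesis using \<open>Re (herm y y) < 0\<close> by (simp add: field_simps)
  qed
  ultimately show thesis using that[of y] \<open>herm c y = 0\<close> yd True by simp
qed

theorem cosh_geodesic_dist:
  assumes c: "herm c c = 1" and d: "herm d d = 1" and k: "1 \<le> cmod (herm c d)"
  shows "cosh (geodesic_dist (geodesic_of c) (geodesic_of d) / 2) = cmod (herm c d)"
    and "0 \<le> geodesic_dist (geodesic_of c) (geodesic_of d)"
proof -
  define k where "k = cmod (herm c d)"
  define r where "r = geodesic_dist (geodesic_of c) (geodesic_of d)"
  define S where "S = (geodesic_of c \<inter> complex_hyperbolic_plane) \<times>
     (geodesic_of d \<inter> complex_hyperbolic_plane)"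
  define X where "X = (\<lambda>(P, Q). rho P Q) ` S"
  have r: "r = Inf X" by (simp add: r_def geodesic_dist_def X_def S_def)
  have k1: "1 \<le> k" using assms by (simp add: k_def)
  obtain z0 w0 where "herm c z0 = 0" "Re (herm z0 z0) < 0" "herm d w0 = 0" "Re (herm w0 w0) < 0"
    using exists_negative_orthogonal c d by metis
  then have "X \<noteq> {}" unfolding X_def S_def geodesic_of_Int_plane by blast
  have lower: "2 * arcosh k \<le> x" "0 \<le> x" if mem: "x \<in> X" for x
  proof -
    obtain P Q where "P \<in> geodesic_of c \<inter> complex_hyperbolic_plane"
      "Q \<in> geodesic_of d \<inter> complex_hyperbolic_plane" "x = rho P Q"
      using mem unfolding X_def S_def by auto
    then obtain z w where z: "herm c z = 0" "Re (herm z z) < 0"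
      and w: "herm d w = 0" "Re (herm w w) < 0" and x: "x = rho (line z) (line w)"
      unfolding geodesic_of_Int_plane by blast
    show x0: "0 \<le> x" using rho_line(1)[OF z(2) w(2)] by (simp add: x)
    have "k\<^sup>2 \<le> (cosh (x / 2))\<^sup>2"
      using herm_orthogonal_product_bound[OF c d \<open>1 \<le> cmod _\<close> z w] z(2) w(2)
      by (simp add: x rho_line(2) k_def le_divide_eq mult_neg_neg)
    then have "k \<le> cosh (x / 2)" by (rule power2_le_imp_le) simp
    then have "cosh (arcosh k) \<le> cosh (x / 2)" using k1 by simp
    then show "2 * arcosh k \<le> x"
      using k1 x0 by (subst (asm) cosh_real_nonneg_le_iff) auto
  qed
  have bdd: "bdd_below X" by (rule bdd_belowI[of X 0]) (rule lower(2))
  have r0: "0 \<le> r" unfolding r by (rule cInf_greatest[OF \<open>X \<noteq> {}\<close> lower(2)])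
  then show "0 \<le> geodesic_dist (geodesic_of c) (geodesic_of d)" by (simp add: r_def)
  have "2 * arcosh k \<le> r" unfolding r by (rule cInf_greatest[OF \<open>X \<noteq> {}\<close> lower(1)])
  then have "cosh (arcosh k) \<le> cosh (r / 2)"
    using k1 r0 by (subst cosh_real_nonneg_le_iff) auto
  then have ge: "k \<le> cosh (r / 2)" using k1 by simp
  have "(cosh (r / 2))\<^sup>2 \<le> k\<^sup>2 + t" if t: "t > 0" for t
  proof -
    obtain z where z: "herm c z = 0" "Re (herm z z) < 0"
      "(cmod (herm z d))\<^sup>2 / (- Re (herm z z)) \<le> k\<^sup>2 - 1 + t"
      using near_minimal_points[OF assms t] unfolding k_def by blast
    define w where "w = z - herm z d *s d"
    note w = projection_distance[OF d z(2), folded w_def]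
    define x where "x = rho (line z) (line w)"
    have "line z \<in> geodesic_of c \<inter> complex_hyperbolic_plane"
      unfolding geodesic_of_Int_plane by (rule CollectI, rule exI[of _ z]) (simp add: z)
    moreover have "line w \<in> geodesic_of d \<inter> complex_hyperbolic_plane"
      unfolding geodesic_of_Int_plane by (rule CollectI, rule exI[of _ w]) (simp add: w)
    ultimately have "x \<in> X" unfolding X_def S_def x_def
      by (intro image_eqI[where x = "(line z, line w)"] SigmaI) simp_all
    then have "r \<le> x" unfolding r using bdd by (rule cInf_lower)
    then have "cosh (r / 2) \<le> cosh (x / 2)" using r0 by (subst cosh_real_nonneg_le_iff) auto
    then have "(cosh (r / 2))\<^sup>2 \<le> (cosh (x / 2))\<^sup>2" by (intro power_mono) auto
    also have "\<dots> \<le> k\<^sup>2 + t" using z(3) by (simp add: x_def rho_line(2)[OF z(2) w(2)] w(3))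
    finally show ?thesis .
  qed
  then have "(cosh (r / 2))\<^sup>2 \<le> k\<^sup>2" by (rule field_le_epsilon)
  then have "cosh (r / 2) \<le> k" using k1 by (auto intro: power2_le_imp_le)
  with ge show "cosh (geodesic_dist (geodesic_of c) (geodesic_of d) / 2) = cmod (herm c d)"
    by (simp add: r_def k_def)
qed

section \<open>Ping-pong in PU(2,1)\<close>

lemma scalars_subset_U21: "scalars \<subseteq> carrier U21"
  by (rule normal_imp_subgroup[OF normal_scalars, THEN subgroup.subset])

lemma mat_scalars [intro]: "cmod a = 1 \<Longrightarrow> mat a \<in> scalars"
  by (auto simp: scalars_def)

lemma PU21_class_eq: "PU21_class A = {mat a ** A | a. cmod a = 1}"
  by (auto simp: PU21_class_def r_coset_def scalars_def)

lemma PU21_class_mem: "A \<in> PU21_class A"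
  by (auto simp: PU21_class_eq intro!: exI[of _ 1])

lemma PU21_class_hom: "PU21_class \<in> hom U21 PU21"
  unfolding PU21_class_def[abs_def] PU21_def by (rule normal.r_coset_hom_Mod[OF normal_scalars])

lemma PU21_class_mult:
  assumes "A \<in> carrier U21" "B \<in> carrier U21"
  shows "PU21_class A \<otimes>\<^bsub>PU21\<^esub> PU21_class B = PU21_class (A ** B)"
  using hom_mult[OF PU21_class_hom assms] by simp

lemma PU21_class_one: "PU21_class (mat 1) = \<one>\<^bsub>PU21\<^esub>"
  using hom_one[OF PU21_class_hom group_U21 group_PU21] by simp

lemma PU21_class_in_carrier: "A \<in> carrier U21 \<Longrightarrow> PU21_class A \<in> carrier PU21"
  unfolding carrier_PU21 by (rule imageI)

lemma U21_mult_closed: "A \<in> carrier U21 \<Longrightarrow> B \<in> carrier U21 \<Longrightarrow> A ** B \<in> carrier U21"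
  using monoid.m_closed[OF group.is_monoid[OF group_U21]] by simp

lemma mat_one_U21: "mat 1 \<in> carrier U21"
  by simp

lemma PU21_class_scalar: "A \<in> scalars \<Longrightarrow> PU21_class A = \<one>\<^bsub>PU21\<^esub>"
  unfolding PU21_def PU21_class_def
  using subgroup.rcos_const[OF normal_imp_subgroup[OF normal_scalars] group_U21]
  by (simp add: FactGroup_def)

lemma mat_left_commute: "B ** (mat a ** A) = mat a ** (B ** A)" for A B :: "complex^3^3"
  by (metis mat_commute matrix_mul_assoc)

lemma continuous_on_matrix_mult_left: "continuous_on S (\<lambda>A :: complex^3^3. B ** A)"
  unfolding matrix_matrix_mult_def by (intro continuous_intros)

text \<open>Discreteness need only be tested at the identity, since left translation by the inverse
  \<open>B'\<close> moves any point there. Invariance of \<open>U\<close> under unit scalars makes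
  \<open>V\<close> saturated, so that its image is open in the quotient.\<close>

lemma discrete_subgroup_PU21I:
  fixes U :: "(complex^3^3) set"
  assumes H: "subgroup H PU21" and U: "open U" "mat 1 \<in> U"
    and scalar: "\<And>a A. cmod a = 1 \<Longrightarrow> A \<in> U \<Longrightarrow> mat a ** A \<in> U"
    and trivial: "\<And>A. A \<in> carrier U21 \<Longrightarrow> A \<in> U \<Longrightarrow> PU21_class A \<in> H \<Longrightarrow> A \<in> scalars"
  shows "discrete_subgroup_PU21 H"
proof -
  interpret PU: group PU21 by (rule group_PU21)
  have HC: "H \<subseteq> carrier PU21" using H by (rule subgroup.subset)
  have top: "topspace PU21_topology = carrier PU21"
    using quotient_imp_surjective_map[OF quotient_map_PU21_class] unfolding carrier_PU21 by simp
  have "openin (subtopology PU21_topology H) {x}" if x: "x \<in> H" for x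
  proof -
    obtain B where B: "B \<in> carrier U21" "x = PU21_class B" using x HC by (auto simp: carrier_PU21)
    obtain B' where B': "B' \<in> carrier U21" "B' ** B = mat 1"
      using group.l_inv_ex[OF group_U21 B(1)] by auto
    have BB': "B ** B' = mat 1" using B'(2) matrix_left_right_inverse by blast
    define V where "V = {A \<in> carrier U21. B' ** A \<in> U}"
    have sat: "A \<in> V" if A: "A \<in> carrier U21" "PU21_class A \<in> PU21_class ` V" for A
    proof -
      obtain A' where A': "A' \<in> V" "PU21_class A = PU21_class A'" using A(2) by blast
      then obtain a where a: "cmod a = 1" "A = mat a ** A'"
        using PU21_class_mem[of A] by (auto simp: PU21_class_eq[of A'])
      have "B' ** A = mat a ** (B' ** A')" by (simp add: a(2) mat_left_commute)
      then show ?thesis using A(1) A'(1) scalar a(1) by (simp add: V_def)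
    qed
    have "{A \<in> carrier U21. PU21_class A \<in> PU21_class ` V} = V"
      using sat by (auto simp: V_def)
    moreover have "openin (top_of_set (carrier U21)) V"
    proof -
      have "V = carrier U21 \<inter> (\<lambda>A. B' ** A) -` U" by (auto simp: V_def)
      then show ?thesis
        using continuous_openin_preimage_gen[OF continuous_on_matrix_mult_left U(1)] by simp
    qed
    moreover have "PU21_class ` V \<subseteq> carrier PU21" by (auto simp: V_def carrier_PU21)
    ultimately have "openin PU21_topology (PU21_class ` V)"
      unfolding openin_PU21_topology by simp
    moreover have "PU21_class ` V \<inter> H = {x}"
    proof (intro equalityI subsetI)
      fix y assume "y \<in> PU21_class ` V \<inter> H"
      then obtain A where A: "A \<in> carrier U21" "B' ** A \<in> U" "y = PU21_class A" "y \<in> H"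
        by (auto simp: V_def)
      have B'H: "PU21_class B' \<in> H"
      proof -
        have "PU21_class B' \<otimes>\<^bsub>PU21\<^esub> x = \<one>\<^bsub>PU21\<^esub>"
          using B B' by (simp add: PU21_class_mult PU21_class_one del: U21_simps)
        then have "PU21_class B' = inv\<^bsub>PU21\<^esub> x"
          using x HC B' by (intro PU.inv_equality[symmetric] PU21_class_in_carrier) auto
        then show ?thesis using H x by (simp add: subgroup.m_inv_closed)
      qed
      have "PU21_class (B' ** A) \<in> H"
        using subgroup.m_closed[OF H B'H A(4)] A B' by (simp add: PU21_class_mult del: U21_simps)
      then have "B' ** A \<in> scalars" using A B' by (intro trivial U21_mult_closed)
      then obtain a where a: "cmod a = 1" "B' ** A = mat a" by (auto simp: scalars_def)
      have "A = B ** (B' ** A)" by (simp add: matrix_mul_assoc BB')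
      then have "A = mat a ** B" by (simp add: a(2) mat_commute)
      then have "A \<in> PU21_class B" using a(1) by (auto simp: PU21_class_eq)
      have "y = PU21_class (mat a) \<otimes>\<^bsub>PU21\<^esub> PU21_class B"
        using \<open>A = mat a ** B\<close> A(3) B(1) a(1) scalars_subset_U21 mat_scalars
        by (subst PU21_class_mult) auto
      then show "y \<in> {x}"
        using PU21_class_scalar[OF mat_scalars[OF a(1)]] B PU21_class_in_carrier by simp
    qed (use x B B' U(2) in \<open>auto simp: V_def\<close>)
    ultimately show ?thesis unfolding openin_subtopology by blast
  qed
  then have "subtopology PU21_topology H = discrete_topology H"
    using HC by (subst eq_commute, subst discrete_topology_unique) (auto simp: top)
  then show ?thesis using H by (simp add: discrete_subgroup_PU21_def)
qed

text \<open>Only left multiplication by generators is allowed. The lifted reflections have finite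
  order, so inverses are words too, and inductions have a single step.\<close>

inductive_set words :: "(complex^3^3) set \<Rightarrow> (complex^3^3) set" for L where
  one: "mat 1 \<in> words L"
| step: "J \<in> L \<Longrightarrow> A \<in> words L \<Longrightarrow> J ** A \<in> words L"

lemma words_mult: "A \<in> words L \<Longrightarrow> B \<in> words L \<Longrightarrow> A ** B \<in> words L"
  by (induction rule: words.induct) (simp_all add: words.step flip: matrix_mul_assoc)

lemma words_power: "J \<in> L \<Longrightarrow> (((**) J) ^^ k) (mat 1) \<in> words L"
  by (induction k) (auto intro: words.intros)

lemma words_U21: "L \<subseteq> carrier U21 \<Longrightarrow> A \<in> words L \<Longrightarrow> A \<in> carrier U21"
  by (rotate_tac, induction rule: words.induct) (auto intro: U21_mult_closed mat_one_U21 simp del: U21_simps)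

lemma generate_PU21_words:
  assumes L: "L \<subseteq> carrier U21" and inv: "\<And>J. J \<in> L \<Longrightarrow> \<exists>A\<in>words L. A ** J = mat 1"
    and h: "h \<in> generate PU21 (PU21_class ` L)"
  shows "\<exists>A\<in>words L. h = PU21_class A"
  using h
proof (induction rule: generate.induct)
  case one
  then show ?case using words.one PU21_class_one by metis
next
  case (incl h)
  then obtain J where "J \<in> L" "h = PU21_class (J ** mat 1)" by auto
  then show ?case using words.intros by blast
next
  case (inv h)
  then obtain J where J: "J \<in> L" "h = PU21_class J" by auto
  then obtain A where A: "A \<in> words L" "A ** J = mat 1" using assms(2) by blast
  have "PU21_class A \<otimes>\<^bsub>PU21\<^esub> h = \<one>\<^bsub>PU21\<^esub>"
    using J A L words_U21[OF L A(1)]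
    by (simp add: PU21_class_mult PU21_class_one subset_iff del: U21_simps)
  then have "inv\<^bsub>PU21\<^esub> h = PU21_class A"
    using J A L words_U21[OF L A(1)]
    by (intro group.inv_equality[OF group_PU21]) (auto intro: PU21_class_in_carrier simp del: U21_simps)
  then show ?case using A by blast
next
  case (eng h1 h2)
  then obtain A B where "A \<in> words L" "h1 = PU21_class A" "B \<in> words L" "h2 = PU21_class B" by blast
  then show ?case using words_mult words_U21[OF L] PU21_class_mult by metis
qed

text \<open>\<open>L\<close> holds the lifts of the generators of G, and \<open>S\<close> an
  explicit set around them. After scaling \<open>q\<close> by 1/\<open>D\<close>, the isometric
  sphere of \<open>I\<close> is where the product with \<open>q\<close> has modulus
  1/\<open>D\<close>. Products are squared distances, so the bound 4\<open>D\<close> in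
  \<open>S_moves\<close> says that \<open>q\<close> moves by at least twice the radius.\<close>

locale ping_pong =
  fixes p q :: "complex^3" and D :: real and I :: "complex^3^3" and L S :: "(complex^3^3) set"
  assumes D: "0 < D" and null: "herm p p = 0" "herm q q = 0" and pq: "herm p q = of_real D"
    and I: "I \<in> carrier U21" "I ** I = mat 1" "I *v p = q"
    and L_S: "L \<subseteq> S" and S_U21: "S \<subseteq> carrier U21" and scalars_S: "scalars \<subseteq> S"
    and L_closed: "\<And>J A. J \<in> L \<Longrightarrow> A \<in> S \<Longrightarrow> J ** A \<in> S"
    and S_scalar: "\<And>a A. cmod a = 1 \<Longrightarrow> A \<in> S \<Longrightarrow> mat a ** A \<in> S"
    and S_fixes: "\<And>A. A \<in> S \<Longrightarrow> \<exists>\<nu>. cmod \<nu> = 1 \<and> A *v p = \<nu> *s p"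
    and S_moves: "\<And>A. A \<in> S \<Longrightarrow> A \<notin> scalars \<Longrightarrow> 4 * D \<le> cmod (herm (A *v q) q)"
begin

text \<open>A point of the geodesic from \<open>q\<close> to \<open>p\<close>, above the top of the
  sphere. Replacing 2 by 1 would put it on the sphere itself; a factor above 1 leaves the gap
  between \<open>D\<close>^2 and 2 \<open>D\<close>^2 on which discreteness rests.\<close>

definition z\<^sub>0 :: "complex^3" where "z\<^sub>0 = q - 2 *s p"

definition inner_half :: "(complex^3) set" where
  "inner_half = {v. cmod (herm v q) < cmod (herm v p)}"

definition outer_half :: "(complex^3) set" where
  "outer_half = {v. cmod (herm v p) < cmod (herm v q)}"

text \<open>Alternating words g_1 I g_2 I ... g_k in which every letter before an \<open>I\<close>
  is nontrivial. The last letter may be a scalar, as \<open>z\<^sub>0\<close> is outside the sphere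
  already.\<close>

inductive_set ready :: "(complex^3^3) set" where
  base: "g \<in> S \<Longrightarrow> g \<in> ready"
| step: "g \<in> S \<Longrightarrow> g \<notin> scalars \<Longrightarrow> B \<in> ready \<Longrightarrow> g ** (I ** B) \<in> ready"

lemma qp: "herm q p = of_real D"
  using pq herm_cnj[of p q] by simp

lemma herm_U21: "A \<in> carrier U21 \<Longrightarrow> herm (A *v z) (A *v w) = herm z w"
  by simp

lemma I_q: "I *v q = p"
  using I by (metis matrix_vector_mul_assoc matrix_vector_mul_lid)

lemma cmod_herm_p: assumes "A \<in> S" shows "cmod (herm (A *v v) p) = cmod (herm v p)"
proof -
  obtain \<nu> where \<nu>: "cmod \<nu> = 1" "A *v p = \<nu> *s p" using S_fixes[OF assms] by blast
  have "cmod (herm (A *v v) p) = cmod (herm (A *v v) (A *v p))"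
    by (simp add: \<nu> herm_scale norm_mult)
  also have "\<dots> = cmod (herm v p)" using herm_U21[of A v p] assms S_U21 by (simp add: subset_iff)
  finally show ?thesis .
qed

lemma z0: "herm z\<^sub>0 z\<^sub>0 = of_real (- 4 * D)" "herm z\<^sub>0 p = of_real D"
  by (simp_all add: z\<^sub>0_def herm_diff herm_scale null pq qp)

lemma z0_negative: "A \<in> carrier U21 \<Longrightarrow> Re (herm (A *v z\<^sub>0) (A *v z\<^sub>0)) < 0"
  using herm_U21[of A] D by (simp add: z0 del: U21_simps)

lemma I_inner_half: assumes "v \<in> outer_half" shows "I *v v \<in> inner_half"
proof -
  have "herm (I *v v) p = herm v q" "herm (I *v v) q = herm v p"
    using herm_U21[OF I(1), of v p] herm_U21[OF I(1), of v q] by (simp_all add: I(3) I_q)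
  then show ?thesis using assms by (simp add: inner_half_def outer_half_def)
qed

text \<open>Otherwise \<open>g *v v\<close> would lie in the closed ball about \<open>q\<close> and
  strictly inside the ball of the same radius about \<open>g *v q\<close>. The triangle inequality
  then contradicts \<open>S_moves\<close>.\<close>

lemma moves_into_outer_half:
  assumes g: "g \<in> S" "g \<notin> scalars" and v: "v \<in> inner_half" "Re (herm v v) < 0"
  shows "g *v v \<in> outer_half"
proof (rule ccontr)
  define u where "u = g *v v"
  assume "g *v v \<notin> outer_half"
  then have 1: "cmod (herm u q) \<le> cmod (herm u p)" by (simp add: outer_half_def u_def)
  have gU: "g \<in> carrier U21" using g S_U21 by blast
  have 2: "cmod (herm u (g *v q)) < cmod (herm u p)"
    using v(1) cmod_herm_p[OF g(1), of v] herm_U21[OF gU, of v q]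
    by (simp add: u_def inner_half_def)
  have up: "herm u p \<noteq> 0" using 2 by auto
  obtain \<nu> where \<nu>: "cmod \<nu> = 1" "g *v p = \<nu> *s p" using S_fixes[OF g(1)] by blast
  have "\<nu> * cnj \<nu> = 1" using \<nu>(1) by (simp flip: complex_norm_square)
  then have \<nu>0: "\<nu> \<noteq> 0" by auto
  have "of_real D = herm (g *v q) (g *v p)" using herm_U21[OF gU, of q p] qp by simp
  then have gqp: "herm (g *v q) p = \<nu> * of_real D"
    using \<open>\<nu> * cnj \<nu> = 1\<close> by (simp add: \<nu>(2) herm_scale mult.assoc[symmetric])
  \<comment> \<open>Scaling makes each product with \<open>p\<close> equal to 1, as the triangle
    inequality requires.\<close>
  define a b u' where "a = (1 / (\<nu> * of_real D)) *s (g *v q)" and "b = (1 / of_real D) *s q"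
    and "u' = (1 / herm u p) *s u"
  have "cmod (herm a b) \<le> 2 * (cmod (herm u' a) + cmod (herm u' b))"
  proof (rule herm_null_triangle[of p])
    show "p \<noteq> 0" using pq D by auto
    have "herm (g *v q) (g *v q) = 0" using herm_U21[OF gU] null by simp
    then show "herm a a = 0" by (simp add: a_def herm_scale)
    show "herm a p = 1" using \<nu>0 D by (simp add: a_def herm_scale gqp)
    show "herm b b = 0" "herm b p = 1" using D by (simp_all add: b_def herm_scale null qp)
    show "herm u' p = 1" using up by (simp add: u'_def herm_scale)
    have "herm u u = of_real (Re (herm v v))"
      using herm_U21[OF gU, of v v] herm_self_Re[of v] by (simp add: u_def)
    then have "herm u' u' = of_real (Re (herm v v) / (cmod (herm u p))\<^sup>2)"
      using complex_norm_square[of "herm u p"] by (simp add: u'_def herm_scale)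
    then show "Re (herm u' u') < 0" using v(2) up by (simp add: divide_neg_pos)
  qed (rule null)
  moreover have "cmod (herm a b) = cmod (herm (g *v q) q) / (D * D)"
    "cmod (herm u' a) = cmod (herm u (g *v q)) / (D * cmod (herm u p))"
    "cmod (herm u' b) = cmod (herm u q) / (D * cmod (herm u p))"
    using D \<nu>(1) by (simp_all add: a_def b_def u'_def herm_scale norm_mult norm_divide)
  ultimately have "cmod (herm (g *v q) q) / (D * D)
    \<le> 2 * (cmod (herm u (g *v q)) + cmod (herm u q)) / (D * cmod (herm u p))"
    by (simp add: add_divide_distrib)
  also have "\<dots> < 2 * (2 * cmod (herm u p)) / (D * cmod (herm u p))"
    using 1 2 D up by (intro divide_strict_right_mono) auto
  also have "\<dots> = 4 * D / (D * D)" using D up by simp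
  finally have "cmod (herm (g *v q) q) < 4 * D" using D by (simp only: divide_less_cancel) simp
  then show False using S_moves[OF g] by simp
qed

text \<open>Since \<open>g\<close> preserves the modulus of the product with \<open>p\<close>, the
  product bound for \<open>p\<close> and \<open>q\<close> forces the product with \<open>q\<close>
  to have modulus at least 2\<open>D\<close>.\<close>

lemma z0_outer_half: assumes g: "g \<in> S" shows "g *v z\<^sub>0 \<in> outer_half"
proof -
  have gU: "g \<in> carrier U21" using g S_U21 by blast
  have 1: "cmod (herm (g *v z\<^sub>0) p) = D" using cmod_herm_p[OF g, of z\<^sub>0] D by (simp add: z0)
  have "4 * D * D \<le> 2 * D * cmod (herm (g *v z\<^sub>0) q)"
    using herm_null_product_bound[OF null z0_negative[OF gU]] herm_U21[OF gU, of z\<^sub>0 z\<^sub>0] D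
    by (simp add: 1 pq z0 del: U21_simps)
  then have "2 * D \<le> cmod (herm (g *v z\<^sub>0) q)" using D by (simp add: mult.assoc)
  then show ?thesis using D 1 by (simp add: outer_half_def)
qed

lemma ready_U21: "B \<in> ready \<Longrightarrow> B \<in> carrier U21"
  by (induction rule: ready.induct) (use S_U21 I(1) in \<open>auto intro!: U21_mult_closed simp del: U21_simps\<close>)

lemma ready_outer_half: "B \<in> ready \<Longrightarrow> B *v z\<^sub>0 \<in> outer_half"
proof (induction rule: ready.induct)
  case (base g)
  then show ?case by (rule z0_outer_half)
next
  case (step g B)
  have "(I ** B) \<in> carrier U21" using I(1) ready_U21 step by (intro U21_mult_closed)
  then show ?case using step I_inner_half z0_negative[of "I ** B"]
    by (auto simp: matrix_vector_mul_assoc[symmetric] simp del: U21_simps intro!: moves_into_outer_half)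
qed

lemma words_normal_form:
  assumes "A \<in> words (insert I L)"
  shows "A \<in> S \<or> (\<exists>g B. g \<in> S \<and> B \<in> ready \<and> A = g ** (I ** B))"
proof -
  have one: "mat 1 \<in> S" using scalars_S mat_scalars[of 1] by auto
  \<comment> \<open>A scalar leading letter is kept as a separate alternative, because then a
    further \<open>I\<close> cancels the next one instead of extending the word.\<close>
  have "A \<in> ready \<or> (\<exists>a B. cmod a = 1 \<and> B \<in> ready \<and> A = mat a ** (I ** B))"
    using assms
  proof (induction rule: words.induct)
    case one
    then show ?case using \<open>mat 1 \<in> S\<close> ready.base by blast
  next
    case (step J A)
    have left: "J ** g \<in> S" if "J \<in> L" "g \<in> S" for g using L_closed that by blast
    have Lcase: "J ** g ** (I ** B) \<in> ready \<or>
      (\<exists>a B'. cmod a = 1 \<and> B' \<in> ready \<and> J ** g ** (I ** B) = mat a ** (I ** B'))"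
      if "J \<in> L" "g \<in> S" "B \<in> ready" for g B
    proof (cases "J ** g \<in> scalars")
      case True
      then obtain a where "cmod a = 1" "J ** g = mat a" by (auto simp: scalars_def)
      then show ?thesis using that(3) by metis
    next
      case False then show ?thesis using ready.step left that by blast
    qed
    have ready_scalar: "mat a ** B \<in> ready" if "cmod a = 1" "B \<in> ready" for a B
      using that(2)
    proof cases
      case base then show ?thesis using S_scalar that(1) ready.base by blast
    next
      case (step g B')
      have "mat a ** g \<notin> scalars"
      proof
        assume "mat a ** g \<in> scalars"
        then obtain b where b: "cmod b = 1" "mat a ** g = mat b" by (auto simp: scalars_def)
        have "a \<noteq> 0" using that(1) by auto
        have "g = mat (b / a)"
        proof (rule matrix_eq[THEN iffD2], rule allI)
          fix x
          have "(mat a ** g) *v x = mat b *v x" by (simp only: b(2))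
          then have "a *s (g *v x) = b *s x" by (simp flip: matrix_vector_mul_assoc)
          then have "g *v x = (b / a) *s x" using \<open>a \<noteq> 0\<close>
            by (simp add: vec_eq_iff field_simps)
          then show "g *v x = mat (b / a) *v x" by simp
        qed
        then have "g \<in> scalars" using b(1) that(1) by (auto simp: norm_divide)
        then show False using step by blast
      qed
      then have "(mat a ** g) ** (I ** B') \<in> ready"
        using step S_scalar[OF that(1)] by (intro ready.step)
      then show ?thesis by (simp add: step matrix_mul_assoc)
    qed
    have II: "I ** (I ** B) = B" for B :: "complex^3^3" by (simp add: I(2) matrix_mul_assoc)
    from step.IH show ?case
    proof (elim disjE exE conjE)
      assume A: "A \<in> ready"
      show ?thesis
      proof (cases "J = I")
        case True
        then have "J ** A = mat 1 ** (I ** A)" by simp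
        then show ?thesis using A norm_one by blast
      next
        case False
        then have J: "J \<in> L" using step.hyps by blast
        from A show ?thesis
        proof cases
          case base then show ?thesis using left J ready.base by blast
        next
          case (step g B)
          then show ?thesis using Lcase[of g B] J by (simp add: matrix_mul_assoc)
        qed
      qed
    next
      fix a B assume a: "cmod a = 1" and B: "B \<in> ready" and A: "A = mat a ** (I ** B)"
      show ?thesis
      proof (cases "J = I")
        case True
        have "I ** A = mat a ** (I ** (I ** B))" by (simp add: A mat_left_commute)
        then show ?thesis using True II ready_scalar[OF a B] by simp
      next
        case False
        then have J: "J \<in> L" using step.hyps by blast
        have "mat a \<in> S" using a scalars_S by blast
        then show ?thesis using Lcase[OF J _ B, of "mat a"] by (simp add: A matrix_mul_assoc)
      qed
    qed
  qed
  then show ?thesis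
  proof (elim disjE exE conjE)
    assume "A \<in> ready"
    then show ?thesis by cases blast+
  next
    fix a B assume "cmod a = 1" "B \<in> ready" "A = mat a ** (I ** B)"
    then show ?thesis using scalars_S mat_scalars by blast
  qed
qed

text \<open>The image of \<open>z\<^sub>0\<close> lies inside the translated sphere about
  \<open>g *v q\<close>. The product bound for \<open>p\<close> and \<open>g *v q\<close> turns this
  into a lower bound, while the identity gives only \<open>D\<close>^2.\<close>

lemma words_bound:
  assumes "A \<in> words (insert I L)" "A \<notin> S"
  shows "2 * D\<^sup>2 < (cmod (herm (A *v z\<^sub>0) p))\<^sup>2"
proof -
  obtain g B where gB: "g \<in> S" "B \<in> ready" "A = g ** (I ** B)"
    using words_normal_form assms by blast
  have gU: "g \<in> carrier U21" using gB S_U21 by blast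
  have AU: "A \<in> carrier U21" using gU gB ready_U21 I(1) by (simp add: U21_mult_closed del: U21_simps)
  define v where "v = I *v (B *v z\<^sub>0)"
  have v: "v \<in> inner_half" unfolding v_def using gB by (intro I_inner_half ready_outer_half)
  have Az: "A *v z\<^sub>0 = g *v v" by (simp add: gB v_def flip: matrix_vector_mul_assoc)
  have lt: "cmod (herm (A *v z\<^sub>0) (g *v q)) < cmod (herm (A *v z\<^sub>0) p)"
    using v herm_U21[OF gU, of v q] cmod_herm_p[OF gB(1), of v]
    by (simp add: Az inner_half_def)
  have "cmod (herm p (g *v q)) = D"
    using cmod_herm_p[OF gB(1), of q] D by (simp add: cmod_herm_commute[of p] qp)
  moreover have "herm (g *v q) (g *v q) = 0" using herm_U21[OF gU] null by simp
  ultimately have "4 * D * D \<le> 2 * cmod (herm (A *v z\<^sub>0) p) * cmod (herm (A *v z\<^sub>0) (g *v q))"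
    using herm_null_product_bound[OF null(1) _ z0_negative[OF AU], of "g *v q"]
      herm_U21[OF AU, of z\<^sub>0 z\<^sub>0] by (simp add: z0)
  also have "\<dots> < 2 * cmod (herm (A *v z\<^sub>0) p) * cmod (herm (A *v z\<^sub>0) p)"
    using lt by (intro mult_strict_left_mono) (auto intro: le_less_trans[OF norm_ge_zero lt])
  finally show ?thesis by (simp add: power2_eq_square)
qed

theorem discrete_generate:
  assumes inv: "\<And>J. J \<in> insert I L \<Longrightarrow> \<exists>A\<in>words (insert I L). A ** J = mat 1"
  shows "discrete_subgroup_PU21 (generate PU21 (PU21_class ` insert I L))"
proof -
  \<comment> \<open>The first condition excludes words outside \<open>S\<close>, by
    \<open>words_bound\<close>; the second excludes nonscalar elements of \<open>S\<close>, by
    \<open>S_moves\<close>.\<close>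
  define U where "U = {A. (cmod (herm (A *v z\<^sub>0) p))\<^sup>2 < 2 * D\<^sup>2 \<and> cmod (herm (A *v q) q) < 4 * D}"
  have LU: "insert I L \<subseteq> carrier U21" using L_S S_U21 I(1) by blast
  show ?thesis
  proof (rule discrete_subgroup_PU21I[of _ U])
    show "subgroup (generate PU21 (PU21_class ` insert I L)) PU21"
      using LU by (intro group.generate_is_subgroup[OF group_PU21]) (auto simp: carrier_PU21 simp del: U21_simps)
    show "open U" unfolding U_def herm_def matrix_vector_mult_def
      by (intro open_Collect_conj open_Collect_less continuous_intros)
    show "mat 1 \<in> U" using D by (simp add: U_def z0 null power2_eq_square)
    fix a :: complex and A assume "cmod a = 1" "A \<in> U"
    then show "mat a ** A \<in> U"
      by (simp add: U_def herm_scale norm_mult flip: matrix_vector_mul_assoc)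
  next
    fix A assume A: "A \<in> carrier U21" "A \<in> U" "PU21_class A \<in> generate PU21 (PU21_class ` insert I L)"
    obtain B where B: "B \<in> words (insert I L)" "PU21_class A = PU21_class B"
      using generate_PU21_words[OF LU inv A(3)] by blast
    have "A \<in> PU21_class B" using PU21_class_mem[of A] by (simp add: B(2))
    then obtain a where a: "cmod a = 1" "A = mat a ** B" by (auto simp: PU21_class_eq)
    have "cmod (herm (A *v z\<^sub>0) p) = cmod (herm (B *v z\<^sub>0) p)"
      using a by (simp add: herm_scale norm_mult flip: matrix_vector_mul_assoc)
    then have "B \<in> S" using words_bound[OF B(1)] A(2) by (auto simp: U_def)
    then have "A \<in> S" using S_scalar a by blast
    then show "A \<in> scalars" using S_moves[of A] A(2) by (auto simp: U_def)
  qed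
qed

end

section \<open>Heisenberg isometries\<close>

abbreviation creflection :: "nat \<Rightarrow> complex^3 \<Rightarrow> complex^3^3" where
  "creflection n c \<equiv> matrix (reflection_map n c)"

abbreviation unity_root :: "nat \<Rightarrow> complex" where
  "unity_root n \<equiv> exp (2 * of_real pi * \<i> / of_nat n)"

lemma refl_apply:
  assumes "herm c c = 1"
  shows "creflection n c *v z = - z + ((1 - unity_root n) * herm z c) *s c"
  using reflection_in_U21(1)[of c n z] assms by (simp add: reflection_map_def)

lemma refl_U21: assumes "herm c c = 1" shows "creflection n c \<in> carrier U21"
  using reflection_in_U21(2)[of c n] assms by (simp del: U21_simps)

lemma root_power: "n > 0 \<Longrightarrow> unity_root n ^ n = 1"
  by (simp add: exp_of_nat_mult[symmetric] exp_eq_1)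

lemma refl_power:
  assumes "herm c c = 1"
  shows "(((**) (creflection n c)) ^^ k) (mat 1) *v z =
    (-1) ^ k *s (z - ((1 - unity_root n ^ k) * herm z c) *s c)"
proof (induction k)
  case (Suc k)
  show ?case
    by (simp add: Suc refl_apply[OF assms] herm_scale herm_diff assms vec_eq_iff algebra_simps
        flip: matrix_vector_mul_assoc)
qed simp

lemma refl_left_inverse:
  assumes "herm c c = 1" "n > 0" "creflection n c \<in> L"
  shows "\<exists>A\<in>words L. A ** creflection n c = mat 1"
proof (intro bexI)
  let ?P = "\<lambda>k. (((**) (creflection n c)) ^^ k) (mat 1)"
  \<comment> \<open>The lift acts as -1 on the complement of \<open>c\<close>, so its n-th power may
    be -1 instead of 1; the exponent 2n always gives the identity.\<close>
  show "?P (2 * n - 1) \<in> words L" using assms(3) by (rule words_power)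
  have "unity_root n ^ (2 * n) = 1" using root_power[OF assms(2)] by (simp add: power_mult mult.commute)
  then have "?P (2 * n) = mat 1"
    by (simp add: matrix_eq refl_power[OF assms(1)])
  moreover have "?P (2 * n) = creflection n c ** ?P (2 * n - 1)"
    using assms(2) by (cases n) auto
  ultimately show "?P (2 * n - 1) ** creflection n c = mat 1"
    using matrix_left_right_inverse by metis
qed

text \<open>A hyperbolic pair \<open>p\<close>, \<open>t\<close> and a unit vector \<open>e\<close>
  orthogonal to both. \<open>D\<close> is not normalised to 1 because \<open>p\<close> is already
  fixed by \<open>e + p\<close> being the polar vector of iota_1.\<close>

locale frame =
  fixes p e t :: "complex^3" and D :: real
  assumes D: "0 < D" and pp: "herm p p = 0" and pe: "herm p e = 0" and ee: "herm e e = 1"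
    and tt: "herm t t = 0" and te: "herm t e = 0" and pt: "herm p t = of_real D"
begin

lemma frame_swap: "herm e p = 0" "herm e t = 0" "herm t p = of_real D"
  using pe te pt herm_cnj[of p e] herm_cnj[of t e] herm_cnj[of p t] by simp_all

lemma frame_span: obtains a b c where "z = a *s p + b *s e + c *s t"
proof -
  define M :: "complex^3^3" where "M = (\<chi> i j. if j = 1 then p $ i else if j = 2 then e $ i else t $ i)"
  have M: "M *v x = x$1 *s p + x$2 *s e + x$3 *s t" for x
    by (simp add: M_def vec_eq_iff matrix_vector_mult_def sum_3 mult.commute)
  have "x = 0" if "M *v x = 0" for x
  proof -
    have "herm (M *v x) p = 0" "herm (M *v x) e = 0" "herm (M *v x) t = 0" using that by simp_all
    then show ?thesis using D
      by (simp add: M herm_add herm_scale pp pe ee tt te pt frame_swap vec_eq_iff forall_3)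
  qed
  then have "inj ((*v) M)"
    by (metis (no_types, opaque_lifting) eq_iff_diff_eq_0 injI matrix_vector_mult_diff_distrib)
  then obtain N where "N ** M = mat 1" using matrix_left_invertible_injective by blast
  then have "M ** N = mat 1" using matrix_left_right_inverse by blast
  then have "z = M *v (N *v z)" by (simp add: matrix_vector_mul_assoc)
  then show thesis using that M by metis
qed

text \<open>Modulo the unit scalar \<open>\<nu>\<close>, this is the Heisenberg isometry with rotational part \<open>\<eta>\<close>,
  translational part \<open>\<eta> * cnj u\<close> and vertical part \<open>\<tau>\<close>; here \<open>p\<close> is the point at infinity and \<open>t\<close>
  the origin.\<close>

definition heisenberg :: "complex^3^3 \<Rightarrow> complex \<Rightarrow> complex \<Rightarrow> complex \<Rightarrow> real \<Rightarrow> bool" where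
  "heisenberg A \<nu> \<eta> u \<tau> \<longleftrightarrow> A *v p = \<nu> *s p \<and> A *v e = \<nu> *s (\<eta> *s e - u *s p) \<and>
     A *v t = \<nu> *s (t + (of_real D * \<eta> * cnj u) *s e
       - (of_real (D / 2) * Complex ((cmod u)\<^sup>2) \<tau>) *s p)"

lemma Complex_norm: "Complex ((cmod u)\<^sup>2) \<tau> = u * cnj u + \<i> * of_real \<tau>"
  unfolding complex_norm_square[symmetric] by (simp add: complex_eq_iff)

lemma heisenberg_scalar:
  assumes "cmod a = 1" shows "heisenberg (mat a) a 1 0 0"
  by (simp add: heisenberg_def vec_eq_iff zero_complex.code[symmetric])

lemma heisenberg_trivial:
  assumes "heisenberg A \<nu> 1 0 0" "cmod \<nu> = 1" shows "A \<in> scalars"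
proof -
  have A: "A *v p = \<nu> *s p" "A *v e = \<nu> *s e" "A *v t = \<nu> *s t"
    using assms(1) by (simp_all add: heisenberg_def zero_complex.code[symmetric])
  have "A *v z = mat \<nu> *v z" for z
  proof -
    obtain a b c where z: "z = a *s p + b *s e + c *s t" by (rule frame_span)
    show ?thesis
      unfolding z matrix_vector_right_distrib vector_scalar_commute A mat_vec
      by (simp add: vec_eq_iff algebra_simps)
  qed
  then have "A = mat \<nu>" by (simp add: matrix_eq del: mat_vec)
  then show ?thesis using assms(2) by auto
qed

text \<open>The Heisenberg group law twisted by rotations; the imaginary part is the symplectic
  cocycle.\<close>

lemma heisenberg_mult:
  assumes A: "heisenberg A \<nu> \<eta> u \<tau>" and B: "heisenberg B \<nu>' \<eta>' u' \<tau>'"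
    and \<eta>: "cmod \<eta> = 1"
  shows "heisenberg (B ** A) (\<nu>' * \<nu>) (\<eta>' * \<eta>) (u + \<eta> * u') (\<tau> + \<tau>' + 2 * Im (\<eta> * u' * cnj u))"
proof -
  have l: "\<eta> * (cnj \<eta> * x) = x" "\<eta> * cnj \<eta> = 1" for x
    using \<eta> by (simp_all flip: complex_norm_square mult.assoc)
  have im: "2 * \<i> * of_real (Im z) = z - cnj z" for z by (simp add: complex_eq_iff)
  define T where "T = \<tau> + \<tau>' + 2 * Im (\<eta> * u' * cnj u)"
  have T: "\<i> * of_real T = \<i> * of_real \<tau> + \<i> * of_real \<tau>'
      + (\<eta> * u' * cnj u - cnj (\<eta> * u' * cnj u))"
    unfolding im[symmetric] T_def by (simp add: algebra_simps)
  have C: "Complex ((cmod (u + \<eta> * u'))\<^sup>2) T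
    = u * cnj u + \<i> * of_real \<tau> + (u' * cnj u' + \<i> * of_real \<tau>') + 2 * \<eta> * u' * cnj u"
    unfolding Complex_norm T by (simp add: algebra_simps l)
  have e: "\<eta>' * \<eta> * cnj (u + \<eta> * u') = \<eta>' * (\<eta> * cnj u + cnj u')"
    by (simp add: algebra_simps l)
  have A': "A *v p = \<nu> *s p" "A *v e = \<nu> *s (\<eta> *s e - u *s p)"
    "A *v t = \<nu> *s (t + (of_real D * \<eta> * cnj u) *s e
       - (of_real (D / 2) * (u * cnj u + \<i> * of_real \<tau>)) *s p)"
    using A unfolding heisenberg_def Complex_norm by blast+
  have B': "B *v p = \<nu>' *s p" "B *v e = \<nu>' *s (\<eta>' *s e - u' *s p)"
    "B *v t = \<nu>' *s (t + (of_real D * \<eta>' * cnj u') *s e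
       - (of_real (D / 2) * (u' * cnj u' + \<i> * of_real \<tau>')) *s p)"
    using B unfolding heisenberg_def Complex_norm by blast+
  have "of_real D * (\<eta>' * \<eta>) * cnj (u + \<eta> * u') = of_real D * (\<eta>' * (\<eta> * cnj u + cnj u'))"
    unfolding e[symmetric] by (simp only: mult.assoc)
  then show ?thesis
    unfolding heisenberg_def T_def[symmetric] C
    by (simp only: matrix_vector_mul_assoc[symmetric] A' vector_scalar_commute
        matrix_vector_right_distrib matrix_vector_mult_diff_distrib B')
      (simp add: vec_eq_iff algebra_simps add_divide_distrib)
qed

lemma heisenberg_refl_e: "heisenberg (creflection n e) (-1) (unity_root n) 0 0"
  by (simp add: heisenberg_def refl_apply[OF ee] pe te ee vec_eq_iff zero_complex.code[symmetric]
      algebra_simps)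

text \<open>This is the rotation about the planar point -1. The bracket |u|^2 + i tau collapses to 2
  (1 - mu), since |1 - mu|^2 = 2 - 2 Re mu for a unit mu.\<close>

lemma heisenberg_refl_ep:
  "heisenberg (creflection n (e + p)) (-1) (unity_root n) (1 - unity_root n) (- 2 * Im (unity_root n))"
proof -
  define \<mu> where "\<mu> = unity_root n"
  have c: "herm (e + p) (e + p) = 1" by (simp add: herm_add ee pp pe frame_swap)
  have \<mu>: "\<mu> * cnj \<mu> = 1" by (simp add: \<mu>_def exp_cnj flip: exp_add)
  have im: "2 * \<i> * of_real (Im z) = z - cnj z" for z by (simp add: complex_eq_iff)
  have T: "\<i> * of_real (- 2 * Im \<mu>) = - (\<mu> - cnj \<mu>)"
    unfolding im[symmetric] by simp
  have C: "Complex ((cmod (1 - \<mu>))\<^sup>2) (- 2 * Im \<mu>) = 2 * (1 - \<mu>)"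
    unfolding Complex_norm T by (simp add: algebra_simps \<mu>)
  have e: "of_real D * \<mu> * cnj (1 - \<mu>) = of_real D * (\<mu> - 1)"
    by (simp add: algebra_simps \<mu>)
  show ?thesis
    unfolding \<mu>_def[symmetric] heisenberg_def C e refl_apply[OF c]
    by (simp add: herm_add pe te pp ee frame_swap vec_eq_iff algebra_simps)
qed

text \<open>Here \<open>q\<close> is the boundary point over \<open>s\<close>. Up to a unit,
  \<open>herm (A *v q) q\<close> is \<open>D\<close>^2/2 times a complex number whose real part is
  the squared planar displacement and whose imaginary part is vertical; each bound keeps one of the
  two.\<close>

lemma heisenberg_displacement:
  fixes s :: complex
  assumes A: "heisenberg A \<nu> \<eta> u \<tau>" and \<nu>: "cmod \<nu> = 1"
    and \<eta>: "cmod \<eta> = 1"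
  defines "q \<equiv> t + (of_real D * cnj s) *s e - of_real (D / 2 * (cmod s)\<^sup>2) *s p"
  shows "D\<^sup>2 / 2 * (cmod ((1 - \<eta>) * s + u))\<^sup>2 \<le> cmod (herm (A *v q) q)"
    and "\<eta> = 1 \<Longrightarrow> u = 0 \<Longrightarrow> D\<^sup>2 / 2 * \<bar>\<tau>\<bar> \<le> cmod (herm (A *v q) q)"
proof -
  have A': "A *v p = \<nu> *s p" "A *v e = \<nu> *s (\<eta> *s e - u *s p)"
    "A *v t = \<nu> *s (t + (of_real D * \<eta> * cnj u) *s e
       - (of_real (D / 2) * (u * cnj u + \<i> * of_real \<tau>)) *s p)"
    using A unfolding heisenberg_def Complex_norm by blast+
  define w where "w = (1 - \<eta>) * s + u"
  define T where "T = \<tau> + 2 * Im (cnj s * u - \<eta> * s * (cnj u + cnj s))"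
  have l: "\<eta> * (cnj \<eta> * x) = x" "\<eta> * cnj \<eta> = 1" for x
    using \<eta> by (simp_all flip: complex_norm_square mult.assoc)
  have im: "2 * \<i> * of_real (Im z) = z - cnj z" for z by (simp add: complex_eq_iff)
  have T: "\<i> * of_real T = \<i> * of_real \<tau> + (cnj s * u - \<eta> * s * (cnj u + cnj s)
     - cnj (cnj s * u - \<eta> * s * (cnj u + cnj s)))"
    unfolding im[symmetric] T_def by (simp add: algebra_simps)
  have C: "Complex ((cmod w)\<^sup>2) T = 2 * s * cnj s + u * cnj u + \<i> * of_real \<tau> + 2 * cnj s * u
     - 2 * \<eta> * s * (cnj u + cnj s)"
    unfolding Complex_norm T w_def by (simp add: algebra_simps l)
  have ss: "of_real (D / 2 * (cmod s)\<^sup>2) = of_real (D / 2) * (s * cnj s)"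
    unfolding complex_norm_square[symmetric] by simp
  have Aq: "A *v q = \<nu> *s (t + (of_real D * \<eta> * cnj u) *s e - (of_real (D / 2) * (u * cnj u + \<i> * of_real \<tau>)) *s p
     + (of_real D * cnj s) *s (\<eta> *s e - u *s p) - (of_real (D / 2) * (s * cnj s)) *s p)"
    unfolding q_def ss
    by (simp only: A' matrix_vector_right_distrib matrix_vector_mult_diff_distrib vector_scalar_commute)
      (simp add: vec_eq_iff algebra_simps)
  have "herm (A *v q) q = - \<nu> * (of_real (D\<^sup>2 / 2) * Complex ((cmod w)\<^sup>2) T)"
    unfolding Aq C unfolding q_def ss
    by (simp add: herm_add herm_diff herm_scale pe te ee pp pt tt frame_swap power2_eq_square
        algebra_simps)
  then have h: "cmod (herm (A *v q) q) = D\<^sup>2 / 2 * cmod (Complex ((cmod w)\<^sup>2) T)"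
    using \<nu> by (simp add: norm_mult norm_power norm_divide)
  show "D\<^sup>2 / 2 * (cmod ((1 - \<eta>) * s + u))\<^sup>2 \<le> cmod (herm (A *v q) q)"
    unfolding h w_def[symmetric]
    using abs_Re_le_cmod[of "Complex ((cmod w)\<^sup>2) T"] by (intro mult_left_mono) auto
  assume "\<eta> = 1" "u = 0"
  then have "T = \<tau>" by (simp add: T_def)
  then show "D\<^sup>2 / 2 * \<bar>\<tau>\<bar> \<le> cmod (herm (A *v q) q)"
    unfolding h using abs_Im_le_cmod[of "Complex ((cmod w)\<^sup>2) T"] by (intro mult_left_mono) auto
qed

text \<open>The set \<open>S\<close> of the ping-pong argument. \<Lambda> is to contain the
  parameters of G, but may be larger and need not be a group.\<close>

definition stabiliser :: "(complex \<times> complex \<times> real) set \<Rightarrow> (complex^3^3) set" where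
  "stabiliser \<Lambda> = {A \<in> carrier U21. \<exists>\<nu> \<eta> u \<tau>. cmod \<nu> = 1 \<and> (\<eta>, u, \<tau>) \<in> \<Lambda> \<and> heisenberg A \<nu> \<eta> u \<tau>}"

text \<open>The rules \<open>closed1\<close> and \<open>closed2\<close> are the group law with one
  reflection on the left. The 8 in \<open>far\<close> arises from 4\<open>D\<close> <=
  (\<open>D\<close>^2/2) |w|^2.\<close>

theorem discrete_reflection_group:
  fixes s :: complex and n\<^sub>1 n\<^sub>2 :: nat and \<Lambda> :: "(complex \<times> complex \<times> real) set"
  defines "q \<equiv> t + (of_real D * cnj s) *s e - of_real (D / 2 * (cmod s)\<^sup>2) *s p"
    and "\<mu> \<equiv> unity_root n\<^sub>1"
  assumes c: "herm c c = 1" and q: "creflection 2 c *v p = q" and n: "n\<^sub>1 > 0" "n\<^sub>2 > 0"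
    and one: "(1, 0, 0) \<in> \<Lambda>"
    and closed1: "\<And>\<eta> u \<tau>. (\<eta>, u, \<tau>) \<in> \<Lambda> \<Longrightarrow>
      (\<mu> * \<eta>, u + \<eta> * (1 - \<mu>), \<tau> - 2 * Im \<mu> + 2 * Im (\<eta> * (1 - \<mu>) * cnj u)) \<in> \<Lambda>"
    and closed2: "\<And>\<eta> u \<tau>. (\<eta>, u, \<tau>) \<in> \<Lambda> \<Longrightarrow> (unity_root n\<^sub>2 * \<eta>, u, \<tau>) \<in> \<Lambda>"
    and unit: "\<And>\<eta> u \<tau>. (\<eta>, u, \<tau>) \<in> \<Lambda> \<Longrightarrow> cmod \<eta> = 1"
    and far: "\<And>\<eta> u \<tau>. (\<eta>, u, \<tau>) \<in> \<Lambda> \<Longrightarrow> (\<eta>, u, \<tau>) \<noteq> (1, 0, 0) \<Longrightarrow>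
      8 \<le> D * (cmod ((1 - \<eta>) * s + u))\<^sup>2 \<or> \<eta> = 1 \<and> u = 0 \<and> 8 \<le> D * \<bar>\<tau>\<bar>"
  shows "discrete_subgroup_PU21
    (generate PU21 (PU21_class ` {creflection 2 c, creflection n\<^sub>1 (e + p), creflection n\<^sub>2 e}))"
proof -
  have ep: "herm (e + p) (e + p) = 1" by (simp add: herm_add ee pp pe frame_swap)
  have ss: "of_real (D / 2 * (cmod s)\<^sup>2) = of_real (D / 2) * (s * cnj s)"
    unfolding complex_norm_square[symmetric] by simp
  interpret ping_pong p q D "creflection 2 c" "{creflection n\<^sub>1 (e + p), creflection n\<^sub>2 e}" "stabiliser \<Lambda>"
  proof
    show "herm p q = of_real D" by (simp add: q_def herm_add herm_diff herm_scale pe pp pt)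
    show "herm q q = 0" unfolding q_def ss
      by (simp add: herm_add herm_diff herm_scale pe te ee pp pt tt frame_swap algebra_simps)
    show "creflection 2 c \<in> carrier U21" by (rule refl_U21[OF c])
    have "unity_root 2 = -1" by simp
    then show "creflection 2 c ** creflection 2 c = mat 1"
      by (simp add: matrix_eq refl_apply[OF c] herm_add herm_minus herm_scale c vec_eq_iff algebra_simps
          flip: matrix_vector_mul_assoc)
    show "scalars \<subseteq> stabiliser \<Lambda>"
      using heisenberg_scalar one scalars_subset_U21
      by (force simp: stabiliser_def scalars_def simp del: U21_simps)
    show "mat a ** A \<in> stabiliser \<Lambda>" if a1: "cmod a = 1" and mem: "A \<in> stabiliser \<Lambda>" for a A
    proof -
      have a: "mat a \<in> carrier U21" using scalars_subset_U21 a1 by blast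
      obtain \<nu> \<eta> u \<tau> where A: "cmod \<nu> = 1" "(\<eta>, u, \<tau>) \<in> \<Lambda>" "heisenberg A \<nu> \<eta> u \<tau>"
        "A \<in> carrier U21" using mem unfolding stabiliser_def by blast
      have "heisenberg (mat a ** A) (a * \<nu>) \<eta> u \<tau>"
        using heisenberg_mult[OF A(3) heisenberg_scalar unit[OF A(2)]] a1 by simp
      moreover have "cmod (a * \<nu>) = 1" using a1 A(1) by (simp add: norm_mult)
      ultimately show ?thesis
        unfolding stabiliser_def using A(2) U21_mult_closed[OF a A(4)] by blast
    qed
    have closed: "J ** A \<in> stabiliser \<Lambda>"
      if J: "J \<in> {creflection n\<^sub>1 (e + p), creflection n\<^sub>2 e}" and mem: "A \<in> stabiliser \<Lambda>" for J A
    proof -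
      obtain \<nu> \<eta> u \<tau> where A: "cmod \<nu> = 1" "(\<eta>, u, \<tau>) \<in> \<Lambda>" "heisenberg A \<nu> \<eta> u \<tau>"
        "A \<in> carrier U21" using mem unfolding stabiliser_def by blast
      have JA: "J ** A \<in> carrier U21" using J refl_U21 ep ee A(4) by (intro U21_mult_closed) auto
      have "\<exists>\<eta>' u' \<tau>'. (\<eta>', u', \<tau>') \<in> \<Lambda> \<and> heisenberg (J ** A) (- 1 * \<nu>) \<eta>' u' \<tau>'"
        using J
      proof (elim insertE emptyE)
        assume "J = creflection n\<^sub>1 (e + p)"
        then show ?thesis
          using heisenberg_mult[OF A(3) heisenberg_refl_ep unit[OF A(2)], of n\<^sub>1] closed1[OF A(2)]
          unfolding \<mu>_def by (metis add_uminus_conv_diff minus_mult_left)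
      next
        assume "J = creflection n\<^sub>2 e"
        then show ?thesis
          using heisenberg_mult[OF A(3) heisenberg_refl_e unit[OF A(2)], of n\<^sub>2] closed2[OF A(2)]
          by auto
      qed
      moreover have "cmod (- 1 * \<nu>) = 1" using A(1) by simp
      ultimately show ?thesis unfolding stabiliser_def using JA by blast
    qed
    then show "J ** A \<in> stabiliser \<Lambda>" if "J \<in> {creflection n\<^sub>1 (e + p), creflection n\<^sub>2 e}" "A \<in> stabiliser \<Lambda>" for J A
      using that by blast
    have "mat 1 \<in> stabiliser \<Lambda>" using \<open>scalars \<subseteq> stabiliser \<Lambda>\<close> mat_scalars[of 1] by auto
    then show "{creflection n\<^sub>1 (e + p), creflection n\<^sub>2 e} \<subseteq> stabiliser \<Lambda>"
      using closed[of _ "mat 1"] by auto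
    show "stabiliser \<Lambda> \<subseteq> carrier U21" unfolding stabiliser_def by blast
    show "\<exists>\<nu>. cmod \<nu> = 1 \<and> A *v p = \<nu> *s p" if "A \<in> stabiliser \<Lambda>" for A
      using that by (auto simp: stabiliser_def heisenberg_def)
    show "4 * D \<le> cmod (herm (A *v q) q)" if A: "A \<in> stabiliser \<Lambda>" "A \<notin> scalars" for A
    proof -
      obtain \<nu> \<eta> u \<tau> where \<nu>: "cmod \<nu> = 1" and \<Lambda>: "(\<eta>, u, \<tau>) \<in> \<Lambda>" and h: "heisenberg A \<nu> \<eta> u \<tau>"
        using A(1) by (auto simp: stabiliser_def)
      note disp = heisenberg_displacement[OF h \<nu> unit[OF \<Lambda>], of s, folded q_def]
      have "(\<eta>, u, \<tau>) \<noteq> (1, 0, 0)" using A(2) heisenberg_trivial h \<nu> by auto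
      from far[OF \<Lambda> this] show ?thesis
      proof (elim disjE conjE)
        assume "8 \<le> D * (cmod ((1 - \<eta>) * s + u))\<^sup>2"
        then have "D / 2 * 8 \<le> D / 2 * (D * (cmod ((1 - \<eta>) * s + u))\<^sup>2)"
          using D by (intro mult_left_mono) auto
        then show ?thesis using disp(1) by (simp add: power2_eq_square)
      next
        assume "\<eta> = 1" "u = 0" "8 \<le> D * \<bar>\<tau>\<bar>"
        then have "D / 2 * 8 \<le> D / 2 * (D * \<bar>\<tau>\<bar>)"
          using D by (intro mult_left_mono) auto
        then show ?thesis using disp(2) \<open>\<eta> = 1\<close> \<open>u = 0\<close> by (simp add: power2_eq_square)
      qed
    qed
  qed (simp_all add: D pp q del: U21_simps)
  show ?thesis
    by (rule discrete_generate) (use refl_left_inverse c ep ee n in auto)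
qed

end

section \<open>Lattices and displacements\<close>

text \<open>\<open>R\<close> is the ring of translations, \<open>U\<close> the set of rotations, and
  \<sigma> the spacing of heights, dictated by the values of 2 Im on \<open>R\<close>. Integrality
  of |1 - mu|^2 keeps the cocycle in the multiples of \<sigma>.\<close>

locale reflection_lattice =
  fixes R U I :: "complex set" and \<mu> \<nu> :: complex and \<sigma> :: real
  assumes R_add: "\<And>z w. z \<in> R \<Longrightarrow> w \<in> R \<Longrightarrow> z + w \<in> R"
    and R_mult: "\<And>z w. z \<in> R \<Longrightarrow> w \<in> R \<Longrightarrow> z * w \<in> R"
    and R_cnj: "\<And>z. z \<in> R \<Longrightarrow> cnj z \<in> R" and R_zero: "0 \<in> R"
    and R_Im: "\<And>z. z \<in> R \<Longrightarrow> \<exists>k::int. 2 * Im z = \<sigma> * of_int k"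
    and U: "U \<subseteq> R" "1 \<in> U" "\<And>\<eta>. \<eta> \<in> U \<Longrightarrow> cmod \<eta> = 1"
      "\<And>\<eta>. \<eta> \<in> U \<Longrightarrow> \<mu> * \<eta> \<in> U" "\<And>\<eta>. \<eta> \<in> U \<Longrightarrow> \<nu> * \<eta> \<in> U"
    and I: "0 \<in> I" "\<And>z w. z \<in> I \<Longrightarrow> w \<in> I \<Longrightarrow> z + w \<in> I"
      "\<And>z w. z \<in> R \<Longrightarrow> w \<in> I \<Longrightarrow> z * w \<in> I" "2 - \<mu> \<in> I" "1 - \<nu> \<in> I"
    and norm_int: "\<exists>k::int. (cmod (1 - \<mu>))\<^sup>2 = of_int k"
begin

text \<open>\<open>I\<close> records which lattice points occur together with a given rotation. It matters for
  \<open>(n\<^sub>1, n\<^sub>2) = (2, 3)\<close> only; otherwise it is all of \<open>R\<close>.\<close>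

definition heisenberg_lattice :: "(complex \<times> complex \<times> real) set" where
  "heisenberg_lattice = {(\<eta>, (1 - \<mu>) * l, \<sigma> * of_int k) | \<eta> l k.
     \<eta> \<in> U \<and> l \<in> R \<and> l - \<eta> + 1 \<in> I}"

lemma heisenberg_lattice_one: "(1, 0, 0) \<in> heisenberg_lattice"
proof -
  have "(1, 0, 0) = (1, (1 - \<mu>) * 0, \<sigma> * of_int 0)" "0 - 1 + 1 \<in> I" using I(1) by simp_all
  then show ?thesis unfolding heisenberg_lattice_def using U(2) R_zero by blast
qed

lemma heisenberg_lattice_unit: "(\<eta>, u, \<tau>) \<in> heisenberg_lattice \<Longrightarrow> cmod \<eta> = 1"
  unfolding heisenberg_lattice_def using U(3) by blast

lemma heisenberg_lattice_closed2:
  assumes "(\<eta>, u, \<tau>) \<in> heisenberg_lattice" shows "(\<nu> * \<eta>, u, \<tau>) \<in> heisenberg_lattice"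
proof -
  obtain l k where l: "\<eta> \<in> U" "l \<in> R" "l - \<eta> + 1 \<in> I" "u = (1 - \<mu>) * l" "\<tau> = \<sigma> * of_int k"
    using assms unfolding heisenberg_lattice_def by blast
  have "l - \<nu> * \<eta> + 1 = (l - \<eta> + 1) + \<eta> * (1 - \<nu>)" by (simp add: algebra_simps)
  also have "\<dots> \<in> I" by (rule I(2)[OF l(3) I(3)[OF subsetD[OF U(1) l(1)] I(5)]])
  finally show ?thesis unfolding heisenberg_lattice_def using l U(5) by blast
qed

lemma heisenberg_lattice_closed1:
  assumes "(\<eta>, u, \<tau>) \<in> heisenberg_lattice"
  shows "(\<mu> * \<eta>, u + \<eta> * (1 - \<mu>), \<tau> - 2 * Im \<mu> + 2 * Im (\<eta> * (1 - \<mu>) * cnj u)) \<in> heisenberg_lattice"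
proof -
  obtain l k where l: "\<eta> \<in> U" "l \<in> R" "l - \<eta> + 1 \<in> I" "u = (1 - \<mu>) * l" "\<tau> = \<sigma> * of_int k"
    using assms unfolding heisenberg_lattice_def by blast
  \<comment> \<open>The first reflection replaces \<open>l\<close> by \<open>l + \<eta>\<close> and
    \<eta> by \<open>\<mu> * \<eta>\<close>; the congruence l = eta - 1 modulo \<open>I\<close>
    survives because \<open>2 - \<mu>\<close> lies in \<open>I\<close>.\<close>
  have "l + \<eta> - \<mu> * \<eta> + 1 = (l - \<eta> + 1) + \<eta> * (2 - \<mu>)" by (simp add: algebra_simps)
  also have "\<dots> \<in> I" by (rule I(2)[OF l(3) I(3)[OF subsetD[OF U(1) l(1)] I(4)]])
  finally have mem: "l + \<eta> - \<mu> * \<eta> + 1 \<in> I" .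
  have "\<mu> \<in> R" using U(1,2) U(4)[of 1] by auto
  then obtain k1 :: int where k1: "2 * Im \<mu> = \<sigma> * of_int k1" using R_Im by blast
  have "\<eta> * cnj l \<in> R" by (rule R_mult[OF subsetD[OF U(1) l(1)] R_cnj[OF l(2)]])
  then obtain k2 :: int where k2: "2 * Im (\<eta> * cnj l) = \<sigma> * of_int k2" using R_Im by blast
  obtain k3 :: int where k3: "(cmod (1 - \<mu>))\<^sup>2 = of_int k3" using norm_int by blast
  have eq: "\<eta> * (1 - \<mu>) * cnj u = of_real ((cmod (1 - \<mu>))\<^sup>2) * (\<eta> * cnj l)"
    unfolding complex_norm_square by (simp add: l(4))
  have "Im (of_real r * z) = r * Im z" for r z by simp
  then have "2 * Im (\<eta> * (1 - \<mu>) * cnj u) = (cmod (1 - \<mu>))\<^sup>2 * (2 * Im (\<eta> * cnj l))"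
    unfolding eq by simp
  then have "\<tau> - 2 * Im \<mu> + 2 * Im (\<eta> * (1 - \<mu>) * cnj u) = \<sigma> * of_int (k - k1 + k3 * k2)"
    unfolding k1 k2 k3 l(5) by (simp add: algebra_simps)
  moreover have "u + \<eta> * (1 - \<mu>) = (1 - \<mu>) * (l + \<eta>)" by (simp add: l(4) algebra_simps)
  moreover have "\<mu> * \<eta> \<in> U" "l + \<eta> \<in> R"
    using U(4)[OF l(1)] R_add[OF l(2) subsetD[OF U(1) l(1)]] by blast+
  ultimately show ?thesis unfolding heisenberg_lattice_def using mem by blast
qed

end

section \<open>Eisenstein and Gaussian integers\<close>

definition int_span :: "complex \<Rightarrow> complex set" where
  "int_span \<zeta> = {of_int a + of_int b * \<zeta> | a b. True}"

lemma int_span_zero: "0 \<in> int_span \<zeta>"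
  unfolding int_span_def by (auto intro!: exI[of _ "0::int"])

lemma int_span_add:
  assumes "z \<in> int_span \<zeta>" "w \<in> int_span \<zeta>" shows "z + w \<in> int_span \<zeta>"
proof -
  obtain a b c d :: int where "z = of_int a + of_int b * \<zeta>" "w = of_int c + of_int d * \<zeta>"
    using assms unfolding int_span_def by blast
  then have "z + w = of_int (a + c) + of_int (b + d) * \<zeta>" by (simp add: algebra_simps)
  then show ?thesis unfolding int_span_def by blast
qed

lemma int_span_mult:
  fixes s :: int
  assumes \<zeta>: "\<zeta> * \<zeta> = of_int s * \<zeta> - 1" and "z \<in> int_span \<zeta>" "w \<in> int_span \<zeta>"
  shows "z * w \<in> int_span \<zeta>"
proof -
  obtain a b c d :: int where zw: "z = of_int a + of_int b * \<zeta>" "w = of_int c + of_int d * \<zeta>"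
    using assms unfolding int_span_def by blast
  have "z * w = of_int (a * c) + of_int (a * d + b * c) * \<zeta> + of_int (b * d) * (\<zeta> * \<zeta>)"
    by (simp add: zw algebra_simps)
  also have "\<dots> = of_int (a * c - b * d) + of_int (a * d + b * c + s * b * d) * \<zeta>"
    unfolding \<zeta> by (simp add: algebra_simps)
  finally show ?thesis unfolding int_span_def by blast
qed

lemma int_span_cnj:
  fixes s :: int
  assumes \<zeta>: "cnj \<zeta> = of_int s - \<zeta>" and "z \<in> int_span \<zeta>" shows "cnj z \<in> int_span \<zeta>"
proof -
  obtain a b :: int where "z = of_int a + of_int b * \<zeta>" using assms unfolding int_span_def by blast
  then have "cnj z = of_int (a + s * b) + of_int (- b) * \<zeta>" by (simp add: \<zeta> algebra_simps)
  then show ?thesis unfolding int_span_def by blast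
qed

lemma int_span_Im: "z \<in> int_span \<zeta> \<Longrightarrow> \<exists>k::int. 2 * Im z = 2 * Im \<zeta> * of_int k"
  unfolding int_span_def by auto

lemma int_spanI: "of_int a + of_int b * \<zeta> = z \<Longrightarrow> z \<in> int_span \<zeta>"
  unfolding int_span_def by blast

text \<open>The primitive sixth root of unity exp(i pi/3); the cube root is
  \<open>omega - 1\<close>.\<close>

definition omega :: complex where "omega = Complex (1 / 2) (sqrt 3 / 2)"

lemma omega_simps [simp]: "Re omega = 1 / 2" "Im omega = sqrt 3 / 2"
  by (simp_all add: omega_def)

lemma sqrt3_mult [simp]: "sqrt 3 * (sqrt 3 * z) = 3 * z"
  by (simp flip: mult.assoc)

lemma omega_square: "omega * omega = omega - 1"
  by (simp add: complex_eq_iff)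

lemma omega_cnj: "cnj omega = 1 - omega"
  by (simp add: complex_eq_iff)

definition units3 :: "complex set" where "units3 = {1, omega - 1, - omega}"
definition units6 :: "complex set" where "units6 = {1, omega, omega - 1, -1, - omega, 1 - omega}"
definition units4 :: "complex set" where "units4 = {1, \<i>, -1, - \<i>}"

lemma cmod_omega_int:
  "(cmod (of_int a + of_int b * omega))\<^sup>2 = of_int (a * a + a * b + b * b)"
  unfolding cmod_power2 by (simp add: power2_eq_square algebra_simps)

lemma eisenstein_small:
  assumes "l \<in> int_span omega" "(cmod l)\<^sup>2 < 3" "l \<noteq> 0" shows "l \<in> units6"
proof -
  obtain a b where l: "l = of_int a + of_int b * omega" using assms(1) unfolding int_span_def by blast
  have lt: "a * a + a * b + b * b < 3" using assms(2) unfolding l cmod_omega_int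
    by (metis of_int_less_iff of_int_numeral)
  \<comment> \<open>Four times the norm form, completed to squares in both ways. The form never
    takes the value 2, so a norm below 3 means a unit.\<close>
  have "(2 * a + b)\<^sup>2 + 3 * b\<^sup>2 < 12" "(2 * b + a)\<^sup>2 + 3 * a\<^sup>2 < 12"
    using lt by (simp_all add: power2_eq_square algebra_simps)
  then have "b\<^sup>2 < 4" "a\<^sup>2 < 4"
    using zero_le_power2[of "2 * a + b"] zero_le_power2[of "2 * b + a"] by (linarith, linarith)
  then have "\<bar>b\<bar> < 2" "\<bar>a\<bar> < 2" using power2_less_imp_less[of "\<bar>b\<bar>" 2] power2_less_imp_less[of "\<bar>a\<bar>" 2] by auto
  then have "a \<in> {-1, 0, 1}" "b \<in> {-1, 0, 1}" by auto
  then show ?thesis using lt assms(3) by (auto simp: l units6_def)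
qed

lemma gaussian_small:
  assumes "l \<in> int_span \<i>" "(cmod l)\<^sup>2 < 2" "l \<noteq> 0" shows "l \<in> units4"
proof -
  obtain a b where l: "l = of_int a + of_int b * \<i>" using assms(1) unfolding int_span_def by blast
  have "(cmod l)\<^sup>2 = of_int (a\<^sup>2 + b\<^sup>2)" by (simp add: l cmod_power2)
  then have lt: "a\<^sup>2 + b\<^sup>2 < 2" using assms(2) by (metis of_int_less_iff of_int_numeral)
  then have "b\<^sup>2 < 4" "a\<^sup>2 < 4"
    using zero_le_power2[of a] zero_le_power2[of b] by (linarith, linarith)
  then have "\<bar>b\<bar> < 2" "\<bar>a\<bar> < 2" using power2_less_imp_less[of "\<bar>b\<bar>" 2] power2_less_imp_less[of "\<bar>a\<bar>" 2] by auto
  then have "a \<in> {-1, 0, 1}" "b \<in> {-1, 0, 1}" by auto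
  then show ?thesis using lt assms(3) by (auto simp: l units4_def)
qed

section \<open>Displacement estimates: long translations, rotations about 0, units\<close>

lemma displacement_if_large:
  assumes "0 \<le> k" "cmod (1 - \<eta>) \<le> h" "cmod s \<le> b" "(k + h) * b \<le> cmod u"
  shows "k\<^sup>2 * (cmod s)\<^sup>2 \<le> (cmod ((1 - \<eta>) * s + u))\<^sup>2"
proof -
  have "0 \<le> h" using assms(2) norm_ge_zero order_trans by blast
  have "(k + cmod (1 - \<eta>)) * cmod s \<le> (k + h) * b"
    using assms \<open>0 \<le> h\<close> by (intro mult_mono) auto
  then have "k * cmod s \<le> cmod u - cmod ((1 - \<eta>) * s)"
    using assms(4) by (simp add: norm_mult distrib_right)
  also have "\<dots> \<le> cmod ((1 - \<eta>) * s + u)"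
    by (metis add.commute norm_diff_ineq)
  finally have "(k * cmod s)\<^sup>2 \<le> (cmod ((1 - \<eta>) * s + u))\<^sup>2"
    using assms(1) by (intro power_mono) auto
  then show ?thesis by (simp add: power_mult_distrib)
qed

lemma displacement_if_zero:
  assumes "0 \<le> k" "k \<le> cmod (1 - \<eta>)"
  shows "k\<^sup>2 * (cmod s)\<^sup>2 \<le> (cmod ((1 - \<eta>) * s))\<^sup>2"
  using assms by (simp add: norm_mult power_mult_distrib mult_right_mono power_mono)

text \<open>If \<open>A = exp (\<i> * \<alpha>) * B\<close> then \<open>B / (A - B)\<close> is \<open>base_ratio (cot (\<alpha> / 2))\<close>, see
  \<open>base_ratio_exp\<close> below.\<close>

definition base_ratio :: "real \<Rightarrow> complex" where "base_ratio x = - Complex (1 / 2) (x / 2)"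

lemma base_ratio_simps [simp]: "Re (base_ratio x) = - 1 / 2" "Im (base_ratio x) = - x / 2"
  by (simp_all add: base_ratio_def)

lemma cmod_base_ratio: "(cmod (base_ratio x))\<^sup>2 = (1 + x\<^sup>2) / 4"
  unfolding cmod_power2 by (simp add: power2_eq_square)

definition eisenstein_ideal :: "complex set" where
  "eisenstein_ideal = {(2 * omega - 1) * z | z. z \<in> int_span omega}"

text \<open>On a + b omega the functional is a - b, the reduction modulo sqrt(-3) = 2 omega - 1,
  because omega is congruent to -1. In this linear form the congruence can enter linear
  arithmetic.\<close>

lemma eisenstein_ideal_residue:
  assumes "z \<in> eisenstein_ideal" shows "\<exists>k::int. Re z - sqrt 3 * Im z = 3 * of_int k"
proof -
  obtain a b :: int where z: "z = (2 * omega - 1) * (of_int a + of_int b * omega)"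
    using assms unfolding eisenstein_ideal_def int_span_def by blast
  have "Re z - sqrt 3 * Im z = 3 * of_int (- a - b)"
    unfolding z by (simp add: algebra_simps)
  then show ?thesis by blast
qed

lemma cmod_one_minus_units:
  "\<eta> \<in> units6 \<Longrightarrow> \<eta> \<noteq> 1 \<Longrightarrow> 1 \<le> cmod (1 - \<eta>)"
  "\<eta> \<in> units3 \<Longrightarrow> \<eta> \<noteq> 1 \<Longrightarrow> cmod (1 - \<eta>) = sqrt 3"
  "\<eta> \<in> units4 \<Longrightarrow> \<eta> \<noteq> 1 \<Longrightarrow> sqrt 2 \<le> cmod (1 - \<eta>)"
  unfolding units6_def units3_def units4_def
  by ((elim insertE emptyE; hypsubst_thin;
    simp add: cmod_def power2_eq_square algebra_simps real_le_lsqrt)+)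

lemma cmod_units: "\<eta> \<in> units6 \<Longrightarrow> cmod \<eta> = 1" "\<eta> \<in> units3 \<Longrightarrow> cmod \<eta> = 1" "\<eta> \<in> units4 \<Longrightarrow> cmod \<eta> = 1"
  unfolding units6_def units3_def units4_def
  by ((elim insertE emptyE; hypsubst_thin; simp add: cmod_def power2_eq_square algebra_simps)+)

lemma cmod_one_minus_le: "cmod \<eta> = 1 \<Longrightarrow> cmod (1 - \<eta>) \<le> 2"
  using norm_triangle_ineq4[of 1 \<eta>] by simp

lemma cmod_le_sqrt: "c \<le> (cmod l)\<^sup>2 \<Longrightarrow> sqrt c \<le> cmod l"
  by (simp add: real_le_lsqrt)

text \<open>The residue rules out the incompatible pairs among the 36. For x >= 0 the pair \<eta> =
  \<open>omega\<close>, l = 1 gives exactly x^2 + 2 sqrt 3 x <= 5, the origin of C = 2 sqrt 2 - sqrt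
  3.\<close>

lemma displacement_units_23:
  fixes k :: int
  assumes "\<eta> \<in> units6" "l \<in> units6" "Re (l - \<eta> + 1) - sqrt 3 * Im (l - \<eta> + 1) = 3 * of_int k"
    "x * x + 2 * \<bar>x * sqrt 3\<bar> \<le> 5" "x * x \<le> 5 / 4"
  shows "3 * (cmod (base_ratio x))\<^sup>2 \<le> (cmod ((1 - \<eta>) * base_ratio x + 2 * l))\<^sup>2"
proof -
  have "k \<le> -2 \<or> k = -1 \<or> k = 0 \<or> k = 1 \<or> 2 \<le> k" by presburger
  then have k: "real_of_int k \<le> -2 \<or> real_of_int k = -1 \<or> real_of_int k = 0 \<or> real_of_int k = 1 \<or> 2 \<le> real_of_int k"
    by auto
  show ?thesis
    unfolding cmod_power2
    by (insert assms(1-3)[unfolded units6_def]; elim insertE emptyE; hypsubst_thin; simp add: power2_eq_square algebra_simps;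
      insert assms(4-) zero_le_square[of x] k; elim disjE; linarith)
qed

text \<open>For x >= 0 the pair \<eta> = -1, l = \<open>omega\<close> gives exactly the first bound
  on x, which is (4 - sqrt 3 x)^2 >= 5.\<close>

lemma displacement_units_26:
  assumes "\<eta> \<in> units6" "l \<in> units6" "8 * \<bar>x * sqrt 3\<bar> \<le> 3 * (x * x) + 11"
    "x * x \<le> 5 / 4" "\<bar>x * sqrt 3\<bar> \<le> 9 / 5"
  shows "(cmod (base_ratio x))\<^sup>2 \<le> (cmod ((1 - \<eta>) * base_ratio x + 2 * l))\<^sup>2"
  unfolding cmod_power2
  by (insert assms(1,2)[unfolded units6_def]; elim insertE emptyE; hypsubst_thin; simp add: power2_eq_square algebra_simps;
      insert assms(3-) zero_le_square[of x]; linarith)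

text \<open>The pair \<eta> = \<open>omega - 1\<close>, l = \<open>omega\<close> requires sqrt 3 x
  <= 1.\<close>

lemma displacement_units_33:
  assumes "\<eta> \<in> units3" "l \<in> units6" "x * x \<le> 1 / 3" "\<bar>x * sqrt 3\<bar> \<le> 1"
  shows "3 * (cmod (base_ratio x))\<^sup>2 \<le> (cmod ((1 - \<eta>) * base_ratio x + (2 - omega) * l))\<^sup>2"
  unfolding cmod_power2
  by (insert assms(1,2)[unfolded units3_def units6_def]; elim insertE emptyE; hypsubst_thin; simp add: power2_eq_square algebra_simps;
      insert assms(3-) zero_le_square[of x]; linarith)

text \<open>The pair \<eta> = i, l = 1 requires x <= 1.\<close>

lemma displacement_units_24:
  assumes "\<eta> \<in> units4" "l \<in> units4" "x * x \<le> 1" "\<bar>x\<bar> \<le> 1"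
  shows "2 * (cmod (base_ratio x))\<^sup>2 \<le> (cmod ((1 - \<eta>) * base_ratio x + 2 * l))\<^sup>2"
  unfolding cmod_power2
  by (insert assms(1,2)[unfolded units4_def]; elim insertE emptyE; hypsubst_thin; simp add: power2_eq_square algebra_simps;
      insert assms(3-) zero_le_square[of x]; linarith)

text \<open>For x >= 0 the pair \<eta> = -1, l = i gives exactly (2 - x)^2 >= 3, hence C = 2 - sqrt
  3.\<close>

lemma displacement_units_44:
  assumes "\<eta> \<in> units4" "l \<in> units4" "4 * \<bar>x\<bar> \<le> x * x + 1" "x * x \<le> 2 / 25" "\<bar>x\<bar> \<le> 1 / 3"
  shows "2 * (cmod (base_ratio x))\<^sup>2 \<le> (cmod ((1 - \<eta>) * base_ratio x + (1 - \<i>) * l))\<^sup>2"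
  unfolding cmod_power2
  by (insert assms(1,2)[unfolded units4_def]; elim insertE emptyE; hypsubst_thin; simp add: power2_eq_square algebra_simps;
      insert assms(3-) zero_le_square[of x]; linarith)

lemma cmod_base_ratio_le: "(1 + x * x) / 4 \<le> b\<^sup>2 \<Longrightarrow> 0 \<le> b \<Longrightarrow> cmod (base_ratio x) \<le> b"
  by (rule power2_le_imp_le[of _ b]) (simp_all add: cmod_base_ratio power2_eq_square[of x])

lemma sqrt3_bounds: "173 / 100 \<le> sqrt 3" "sqrt 3 \<le> 174 / 100"
  by (rule real_le_rsqrt, simp add: power2_eq_square) (rule real_le_lsqrt, simp_all add: power2_eq_square)

lemma sqrt2_bounds: "141 / 100 \<le> sqrt 2" "sqrt 2 \<le> 1415 / 1000"
  by (rule real_le_rsqrt, simp add: power2_eq_square) (rule real_le_lsqrt, simp_all add: power2_eq_square)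

lemma sqrt5_bound: "11 / 5 \<le> sqrt 5"
  by (rule real_le_rsqrt) (simp add: power2_eq_square)

lemma cmod_two_minus_omega: "cmod (2 - omega) = sqrt 3"
  by (simp add: cmod_def power2_eq_square)

lemma displacement_23:
  assumes x: "\<bar>x\<bar> \<le> 2 * sqrt 2 - sqrt 3" and \<eta>: "\<eta> \<in> units6" and l: "l \<in> int_span omega"
    and I: "l - \<eta> + 1 \<in> eisenstein_ideal" and ne: "(\<eta>, l) \<noteq> (1, 0)"
  shows "3 * (cmod (base_ratio x))\<^sup>2 \<le> (cmod ((1 - \<eta>) * base_ratio x + 2 * l))\<^sup>2"
proof -
  obtain k where k: "Re (l - \<eta> + 1) - sqrt 3 * Im (l - \<eta> + 1) = 3 * of_int k"
    using eisenstein_ideal_residue[OF I] by blast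
  have "\<bar>x\<bar> \<le> 11 / 10" using x sqrt2_bounds sqrt3_bounds by linarith
  then have "\<bar>x\<bar> * \<bar>x\<bar> \<le> 11 / 10 * (11 / 10)" by (intro mult_mono) auto
  then have xx: "x * x \<le> 5 / 4" by simp
  have "(\<bar>x\<bar> + sqrt 3) * (\<bar>x\<bar> + sqrt 3) \<le> (2 * sqrt 2) * (2 * sqrt 2)"
    using x by (intro mult_mono) auto
  then have xy: "x * x + 2 * \<bar>x * sqrt 3\<bar> \<le> 5" by (simp add: algebra_simps abs_mult)
  consider "l = 0" | "l \<noteq> 0" "(cmod l)\<^sup>2 < 3" | "3 \<le> (cmod l)\<^sup>2" by linarith
  then show ?thesis
  proof cases
    case 1
    have "k \<le> -1 \<or> k = 0 \<or> 1 \<le> k" by presburger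
    then have k': "real_of_int k \<le> -1 \<or> real_of_int k = 0 \<or> 1 \<le> real_of_int k" by auto
    \<comment> \<open>With l = 0 the residue concerns 1 - eta and leaves only the cube roots of
      unity. This is the purpose of the ideal: a rotation of order 6 about 0 would give |1 - eta| =
      1 instead of sqrt 3.\<close>
    have "\<eta> \<in> units3"
      by (insert \<eta>[unfolded units6_def] k[unfolded 1]; elim insertE emptyE; hypsubst_thin;
        simp add: units3_def algebra_simps; insert k'; linarith)
    then have "cmod (1 - \<eta>) = sqrt 3" using cmod_one_minus_units(2) ne 1 by auto
    then show ?thesis using displacement_if_zero[of "sqrt 3" \<eta> "base_ratio x"] by (simp add: 1)
  next
    case 2
    then have "l \<in> units6" using eisenstein_small[OF l] by blast
    then show ?thesis using displacement_units_23[OF \<eta> _ k xy xx] by blast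
  next
    case 3
    then have "sqrt 3 \<le> cmod l" by (rule cmod_le_sqrt)
    \<comment> \<open>Worst case of the triangle inequality: |1 - eta| is at most 2 and |s| at most
      3/4.\<close>
    moreover have "(sqrt 3 + 2) * (3 / 4) \<le> 2 * sqrt 3" using sqrt3_bounds(1) by (simp add: field_simps)
    ultimately have "(sqrt 3 + 2) * (3 / 4) \<le> cmod (2 * l)" by (simp add: norm_mult)
    moreover have "cmod (base_ratio x) \<le> 3 / 4" using xx by (intro cmod_base_ratio_le) (simp_all add: power2_eq_square)
    ultimately show ?thesis
      using displacement_if_large[of "sqrt 3" \<eta> 2 "base_ratio x" "3 / 4" "2 * l"] cmod_one_minus_le[OF cmod_units(1)[OF \<eta>]]
      by simp
  qed
qed

lemma displacement_26:
  assumes x: "\<bar>x\<bar> \<le> (4 - sqrt 5) / sqrt 3" and \<eta>: "\<eta> \<in> units6" and l: "l \<in> int_span omega"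
    and ne: "(\<eta>, l) \<noteq> (1, 0)"
  shows "(cmod (base_ratio x))\<^sup>2 \<le> (cmod ((1 - \<eta>) * base_ratio x + 2 * l))\<^sup>2"
proof -
  have y: "\<bar>x * sqrt 3\<bar> \<le> 4 - sqrt 5" using x by (simp add: abs_mult field_simps)
  then have y2: "\<bar>x * sqrt 3\<bar> \<le> 9 / 5" using sqrt5_bound by linarith
  then have "\<bar>x * sqrt 3\<bar> * \<bar>x * sqrt 3\<bar> \<le> 9 / 5 * (9 / 5)" by (intro mult_mono) auto
  then have xx: "x * x \<le> 5 / 4" by (simp add: algebra_simps)
  have "sqrt 5 * sqrt 5 \<le> (4 - \<bar>x * sqrt 3\<bar>) * (4 - \<bar>x * sqrt 3\<bar>)"
    using y y2 by (intro mult_mono) auto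
  then have xy: "8 * \<bar>x * sqrt 3\<bar> \<le> 3 * (x * x) + 11" by (simp add: algebra_simps abs_mult)
  consider "l = 0" | "l \<noteq> 0" "(cmod l)\<^sup>2 < 3" | "3 \<le> (cmod l)\<^sup>2" by linarith
  then show ?thesis
  proof cases
    case 1
    then have "1 \<le> cmod (1 - \<eta>)" using cmod_one_minus_units(1)[OF \<eta>] ne by auto
    then show ?thesis using displacement_if_zero[of 1 \<eta> "base_ratio x"] by (simp add: 1)
  next
    case 2
    then have "l \<in> units6" using eisenstein_small[OF l] by blast
    then show ?thesis using displacement_units_26[OF \<eta> _ xy xx y2] by blast
  next
    case 3
    then have "sqrt 3 \<le> cmod l" by (rule cmod_le_sqrt)
    then have "(1 + 2) * (3 / 4) \<le> cmod (2 * l)" using sqrt3_bounds by (simp add: norm_mult)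
    moreover have "cmod (base_ratio x) \<le> 3 / 4" using xx by (intro cmod_base_ratio_le) (simp_all add: power2_eq_square)
    ultimately show ?thesis
      using displacement_if_large[of 1 \<eta> 2 "base_ratio x" "3 / 4" "2 * l"] cmod_one_minus_le[OF cmod_units(1)[OF \<eta>]]
      by simp
  qed
qed

lemma inverse_sqrt3_bounds:
  assumes "\<bar>x\<bar> \<le> 1 / sqrt 3"
  shows "\<bar>x * sqrt 3\<bar> \<le> 1" "x * x \<le> 1 / 3" "cmod (base_ratio x) \<le> 1 / sqrt 3"
proof -
  show y: "\<bar>x * sqrt 3\<bar> \<le> 1" using assms by (simp add: abs_mult field_simps)
  then have "\<bar>x * sqrt 3\<bar> * \<bar>x * sqrt 3\<bar> \<le> 1 * 1" by (intro mult_mono) auto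
  then show "x * x \<le> 1 / 3" by (simp add: algebra_simps)
  then show "cmod (base_ratio x) \<le> 1 / sqrt 3" by (intro cmod_base_ratio_le) (simp_all add: power_divide)
qed

lemma displacement_33:
  assumes x: "\<bar>x\<bar> \<le> 1 / sqrt 3" and \<eta>: "\<eta> \<in> units3" and l: "l \<in> int_span omega"
    and ne: "(\<eta>, l) \<noteq> (1, 0)"
  shows "3 * (cmod (base_ratio x))\<^sup>2 \<le> (cmod ((1 - \<eta>) * base_ratio x + (2 - omega) * l))\<^sup>2"
proof -
  consider "l = 0" | "l \<noteq> 0" "(cmod l)\<^sup>2 < 3" | "3 \<le> (cmod l)\<^sup>2" by linarith
  then show ?thesis
  proof cases
    case 1
    then have "cmod (1 - \<eta>) = sqrt 3" using cmod_one_minus_units(2)[OF \<eta>] ne by auto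
    then show ?thesis using displacement_if_zero[of "sqrt 3" \<eta> "base_ratio x"] by (simp add: 1)
  next
    case 2
    then have "l \<in> units6" using eisenstein_small[OF l] by blast
    then show ?thesis using displacement_units_33[OF \<eta>] inverse_sqrt3_bounds[OF x] by blast
  next
    case 3
    then have "sqrt 3 * sqrt 3 \<le> sqrt 3 * cmod l" by (intro mult_left_mono cmod_le_sqrt) auto
    then have "(sqrt 3 + sqrt 3) * (1 / sqrt 3) \<le> cmod ((2 - omega) * l)"
      by (simp add: norm_mult cmod_two_minus_omega)
    moreover have "cmod (1 - \<eta>) \<le> sqrt 3" using cmod_one_minus_units(2)[OF \<eta>] by (cases "\<eta> = 1") auto
    ultimately show ?thesis
      using displacement_if_large[of "sqrt 3" \<eta> "sqrt 3" "base_ratio x" "1 / sqrt 3" "(2 - omega) * l"]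
        inverse_sqrt3_bounds[OF x] by simp
  qed
qed

text \<open>Units need no inspection here: a nonzero \<open>l\<close> gives a translation of length
  at least sqrt 3 = (1 + 2) / sqrt 3, enough for the triangle inequality.\<close>

lemma displacement_36:
  assumes x: "\<bar>x\<bar> \<le> 1 / sqrt 3" and \<eta>: "\<eta> \<in> units6" and l: "l \<in> int_span omega"
    and ne: "(\<eta>, l) \<noteq> (1, 0)"
  shows "(cmod (base_ratio x))\<^sup>2 \<le> (cmod ((1 - \<eta>) * base_ratio x + (2 - omega) * l))\<^sup>2"
proof (cases "l = 0")
  case True
  then have "1 \<le> cmod (1 - \<eta>)" using cmod_one_minus_units(1)[OF \<eta>] ne by auto
  then show ?thesis using displacement_if_zero[of 1 \<eta> "base_ratio x"] by (simp add: True)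
next
  case False
  have "1 \<le> cmod l"
  proof (cases "(cmod l)\<^sup>2 < 3")
    case True
    then show ?thesis using eisenstein_small[OF l] False cmod_units(1) by fastforce
  next
    case False
    then show ?thesis using cmod_le_sqrt[of 1 l] by simp
  qed
  then have "sqrt 3 * 1 \<le> sqrt 3 * cmod l" by (intro mult_left_mono) auto
  then have "(1 + 2) * (1 / sqrt 3) \<le> cmod ((2 - omega) * l)"
    by (simp add: norm_mult cmod_two_minus_omega real_div_sqrt)
  then show ?thesis
    using displacement_if_large[of 1 \<eta> 2 "base_ratio x" "1 / sqrt 3" "(2 - omega) * l"]
      inverse_sqrt3_bounds[OF x] cmod_one_minus_le[OF cmod_units(1)[OF \<eta>]] by simp
qed

lemma displacement_24:
  assumes x: "\<bar>x\<bar> \<le> 1" and \<eta>: "\<eta> \<in> units4" and l: "l \<in> int_span \<i>"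
    and ne: "(\<eta>, l) \<noteq> (1, 0)"
  shows "2 * (cmod (base_ratio x))\<^sup>2 \<le> (cmod ((1 - \<eta>) * base_ratio x + 2 * l))\<^sup>2"
proof -
  have "\<bar>x\<bar> * \<bar>x\<bar> \<le> 1 * 1" using x by (intro mult_mono) auto
  then have xx: "x * x \<le> 1" by simp
  consider "l = 0" | "l \<noteq> 0" "(cmod l)\<^sup>2 < 2" | "2 \<le> (cmod l)\<^sup>2" by linarith
  then show ?thesis
  proof cases
    case 1
    then have "sqrt 2 \<le> cmod (1 - \<eta>)" using cmod_one_minus_units(3)[OF \<eta>] ne by auto
    then show ?thesis using displacement_if_zero[of "sqrt 2" \<eta> "base_ratio x"] by (simp add: 1)
  next
    case 2
    then have "l \<in> units4" using gaussian_small[OF l] by blast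
    then show ?thesis using displacement_units_24[OF \<eta> _ xx x] by blast
  next
    case 3
    then have "sqrt 2 \<le> cmod l" by (rule cmod_le_sqrt)
    moreover have "(sqrt 2 + 2) * (71 / 100) \<le> 2 * sqrt 2" using sqrt2_bounds(1) by (simp add: field_simps)
    ultimately have "(sqrt 2 + 2) * (71 / 100) \<le> cmod (2 * l)" by (simp add: norm_mult)
    moreover have "cmod (base_ratio x) \<le> 71 / 100" using xx by (intro cmod_base_ratio_le) (simp_all add: power2_eq_square)
    ultimately show ?thesis
      using displacement_if_large[of "sqrt 2" \<eta> 2 "base_ratio x" "71 / 100" "2 * l"] cmod_one_minus_le[OF cmod_units(3)[OF \<eta>]]
      by simp
  qed
qed

lemma displacement_44:
  assumes x: "\<bar>x\<bar> \<le> 2 - sqrt 3" and \<eta>: "\<eta> \<in> units4" and l: "l \<in> int_span \<i>"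
    and ne: "(\<eta>, l) \<noteq> (1, 0)"
  shows "2 * (cmod (base_ratio x))\<^sup>2 \<le> (cmod ((1 - \<eta>) * base_ratio x + (1 - \<i>) * l))\<^sup>2"
proof -
  have x3: "\<bar>x\<bar> \<le> 27 / 100" using x sqrt3_bounds by linarith
  then have "\<bar>x\<bar> * \<bar>x\<bar> \<le> 27 / 100 * (27 / 100)" by (intro mult_mono) auto
  then have xx: "x * x \<le> 2 / 25" by simp
  have "sqrt 3 * sqrt 3 \<le> (2 - \<bar>x\<bar>) * (2 - \<bar>x\<bar>)" using x x3 by (intro mult_mono) auto
  then have xy: "4 * \<bar>x\<bar> \<le> x * x + 1" by (simp add: algebra_simps)
  consider "l = 0" | "l \<noteq> 0" "(cmod l)\<^sup>2 < 2" | "2 \<le> (cmod l)\<^sup>2" by linarith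
  then show ?thesis
  proof cases
    case 1
    then have "sqrt 2 \<le> cmod (1 - \<eta>)" using cmod_one_minus_units(3)[OF \<eta>] ne by auto
    then show ?thesis using displacement_if_zero[of "sqrt 2" \<eta> "base_ratio x"] by (simp add: 1)
  next
    case 2
    then have "l \<in> units4" using gaussian_small[OF l] by blast
    then show ?thesis using displacement_units_44[OF \<eta> _ xy xx] x3 by simp
  next
    case 3
    have c: "cmod (1 - \<i>) = sqrt 2" by (simp add: cmod_def)
    have "sqrt 2 * sqrt 2 \<le> sqrt 2 * cmod l" using 3 by (intro mult_left_mono cmod_le_sqrt) auto
    moreover have "(sqrt 2 + 2) * (53 / 100) \<le> 2" using sqrt2_bounds(2) by (simp add: field_simps)
    ultimately have "(sqrt 2 + 2) * (53 / 100) \<le> cmod ((1 - \<i>) * l)" by (simp add: norm_mult c)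
    moreover have "cmod (base_ratio x) \<le> 53 / 100" using xx by (intro cmod_base_ratio_le) (simp_all add: power2_eq_square)
    ultimately show ?thesis
      using displacement_if_large[of "sqrt 2" \<eta> 2 "base_ratio x" "53 / 100" "(1 - \<i>) * l"] cmod_one_minus_le[OF cmod_units(3)[OF \<eta>]]
      by simp
  qed
qed

section \<open>The lattices for the six pairs of orders\<close>

lemma roots: "exp (2 * of_real pi * \<i> / of_nat 2) = -1" "exp (2 * of_real pi * \<i> / of_nat 3) = omega - 1"
  "exp (2 * of_real pi * \<i> / of_nat 4) = \<i>" "exp (2 * of_real pi * \<i> / of_nat 6) = omega"
proof -
  have e: "exp (2 * of_real pi * \<i> / of_nat n) = cis (2 * pi / n)" for n
    by (simp add: cis_conv_exp mult.commute)
  have "2 * pi / 3 = pi - pi / 3" by simp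
  then have "cos (2 * pi / 3) = - 1 / 2" "sin (2 * pi / 3) = sqrt 3 / 2"
    by (simp_all only: cos_pi_minus sin_pi_minus cos_60 sin_60)
  then show "exp (2 * of_real pi * \<i> / of_nat 2) = -1" "exp (2 * of_real pi * \<i> / of_nat 3) = omega - 1"
    "exp (2 * of_real pi * \<i> / of_nat 4) = \<i>" "exp (2 * of_real pi * \<i> / of_nat 6) = omega"
    unfolding e by (simp_all add: complex_eq_iff cos_60 sin_60)
qed

lemma units6_subset: "units6 \<subseteq> int_span omega"
proof -
  have "1 \<in> int_span omega" by (rule int_spanI[of 1 0]) simp
  moreover have "omega \<in> int_span omega" by (rule int_spanI[of 0 1]) simp
  moreover have "omega - 1 \<in> int_span omega" by (rule int_spanI[of "-1" 1]) simp
  moreover have "-1 \<in> int_span omega" by (rule int_spanI[of "-1" 0]) simp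
  moreover have "- omega \<in> int_span omega" by (rule int_spanI[of 0 "-1"]) simp
  moreover have "1 - omega \<in> int_span omega" by (rule int_spanI[of 1 "-1"]) simp
  ultimately show ?thesis unfolding units6_def by blast
qed

lemma units3_subset: "units3 \<subseteq> units6"
  unfolding units3_def units6_def by blast

lemma units4_subset: "units4 \<subseteq> int_span \<i>"
proof -
  have "1 \<in> int_span \<i>" by (rule int_spanI[of 1 0]) simp
  moreover have "\<i> \<in> int_span \<i>" by (rule int_spanI[of 0 1]) simp
  moreover have "-1 \<in> int_span \<i>" by (rule int_spanI[of "-1" 0]) simp
  moreover have "- \<i> \<in> int_span \<i>" by (rule int_spanI[of 0 "-1"]) simp
  ultimately show ?thesis unfolding units4_def by blast
qed

lemma units_mult:
  "\<eta> \<in> units6 \<Longrightarrow> omega * \<eta> \<in> units6" "\<eta> \<in> units6 \<Longrightarrow> - \<eta> \<in> units6"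
  "\<eta> \<in> units6 \<Longrightarrow> (omega - 1) * \<eta> \<in> units6" "\<eta> \<in> units3 \<Longrightarrow> (omega - 1) * \<eta> \<in> units3"
  "\<eta> \<in> units4 \<Longrightarrow> \<i> * \<eta> \<in> units4" "\<eta> \<in> units4 \<Longrightarrow> - \<eta> \<in> units4"
  unfolding units6_def units3_def units4_def
  by ((elim insertE emptyE; hypsubst_thin; simp add: algebra_simps omega_square)+)

lemma eisenstein_ring:
  shows "z \<in> int_span omega \<Longrightarrow> w \<in> int_span omega \<Longrightarrow> z * w \<in> int_span omega"
    and "z \<in> int_span omega \<Longrightarrow> cnj z \<in> int_span omega"
    and "z \<in> int_span omega \<Longrightarrow> \<exists>k::int. 2 * Im z = sqrt 3 * of_int k"
  using int_span_mult[of omega 1 z w] int_span_cnj[of omega 1 z] int_span_Im[of z omega]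
  by (simp_all add: omega_square omega_cnj)

text \<open>The triples belong to the pairs (3,3), (2,6) and (3,6) in this order; the ideal is the
  whole ring.\<close>

lemma reflection_lattice_eisenstein:
  assumes U: "(U, \<mu>, \<nu>) \<in> {(units3, omega - 1, omega - 1), (units6, -1, omega), (units6, omega - 1, omega)}"
  shows "reflection_lattice (int_span omega) U (int_span omega) \<mu> \<nu> (sqrt 3)"
proof
  have "2 \<in> int_span omega" "3 \<in> int_span omega" "3 - omega \<in> int_span omega" "2 - omega \<in> int_span omega"
    by (rule int_spanI[of 2 0], simp) (rule int_spanI[of 3 0], simp, rule int_spanI[of 3 "-1"], simp,
      rule int_spanI[of 2 "-1"], simp)
  moreover have "1 - omega \<in> int_span omega" using units6_subset by (auto simp: units6_def)
  ultimately show "2 - \<mu> \<in> int_span omega" "1 - \<nu> \<in> int_span omega" using U by auto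
  show "\<exists>k::int. (cmod (1 - \<mu>))\<^sup>2 = of_int k"
    using U by (auto simp: cmod_two_minus_omega intro: exI[of _ 3] exI[of _ 4])
  show "U \<subseteq> int_span omega" using U units6_subset units3_subset by auto
  show "1 \<in> U" using U by (auto simp: units3_def units6_def)
  show "cmod \<eta> = 1" if "\<eta> \<in> U" for \<eta> using that U cmod_units by auto
  show "\<mu> * \<eta> \<in> U" "\<nu> * \<eta> \<in> U" if "\<eta> \<in> U" for \<eta> using that U units_mult by auto
qed (fact eisenstein_ring int_span_add int_span_zero)+

lemma eisenstein_idealI: "z \<in> int_span omega \<Longrightarrow> (2 * omega - 1) * z = w \<Longrightarrow> w \<in> eisenstein_ideal"
  unfolding eisenstein_ideal_def by blast

lemma reflection_lattice_eisenstein_ideal: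
  "reflection_lattice (int_span omega) units6 eisenstein_ideal (-1) (omega - 1) (sqrt 3)"
proof -
  \<comment> \<open>The pair (2,6) has the same ring, rotations and \<open>\<mu>\<close>, so only
    the clauses on the ideal and on the second root need new proofs.\<close>
  interpret reflection_lattice "int_span omega" units6 "int_span omega" "-1" omega "sqrt 3"
    by (rule reflection_lattice_eisenstein) simp
  show ?thesis
  proof
    show "2 - - 1 \<in> eisenstein_ideal"
    proof (rule eisenstein_idealI)
      show "1 - 2 * omega \<in> int_span omega" by (rule int_spanI[of 1 "-2"]) simp
      show "(2 * omega - 1) * (1 - 2 * omega) = 2 - - 1"
        by (simp add: complex_eq_iff)
    qed
    show "1 - (omega - 1) \<in> eisenstein_ideal"
    proof (rule eisenstein_idealI)
      show "- omega \<in> int_span omega" using units6_subset by (auto simp: units6_def)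
      show "(2 * omega - 1) * - omega = 1 - (omega - 1)"
        by (simp add: complex_eq_iff)
    qed
    show "0 \<in> eisenstein_ideal" by (rule eisenstein_idealI[OF R_zero]) simp
    show "z + w \<in> eisenstein_ideal" if "z \<in> eisenstein_ideal" "w \<in> eisenstein_ideal" for z w
      using that R_add unfolding eisenstein_ideal_def by (auto simp flip: distrib_left)
    show "z * w \<in> eisenstein_ideal" if z: "z \<in> int_span omega" and w: "w \<in> eisenstein_ideal" for z w
    proof -
      obtain v where v: "v \<in> int_span omega" "w = (2 * omega - 1) * v"
        using w unfolding eisenstein_ideal_def by blast
      show ?thesis by (rule eisenstein_idealI[OF R_mult[OF z v(1)]]) (simp add: v(2))
    qed
  qed (fact R_add R_mult R_cnj R_zero R_Im U(1-4) units_mult(3) norm_int)+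
qed

lemma reflection_lattice_gaussian:
  assumes \<mu>: "\<mu> \<in> {-1, \<i>}"
  shows "reflection_lattice (int_span \<i>) units4 (int_span \<i>) \<mu> \<i> 2"
proof
  have mult: "z * w \<in> int_span \<i>" if "z \<in> int_span \<i>" "w \<in> int_span \<i>" for z w
    using that int_span_mult[of \<i> 0] by simp
  show "cnj z \<in> int_span \<i>" if "z \<in> int_span \<i>" for z
    using that int_span_cnj[of \<i> 0] by simp
  show "\<exists>k::int. 2 * Im z = 2 * of_int k" if "z \<in> int_span \<i>" for z
    using that int_span_Im[of z \<i>] by simp
  have "3 \<in> int_span \<i>" "2 - \<i> \<in> int_span \<i>"
    by (rule int_spanI[of 3 0], simp) (rule int_spanI[of 2 "-1"], simp)
  then show "2 - \<mu> \<in> int_span \<i>" using \<mu> by auto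
  show "1 - \<i> \<in> int_span \<i>" by (rule int_spanI[of 1 "-1"]) simp
  show "\<exists>k::int. (cmod (1 - \<mu>))\<^sup>2 = of_int k"
    using \<mu> by (auto simp: cmod_def intro: exI[of _ 2] exI[of _ 4])
  show "1 \<in> units4" by (simp add: units4_def)
  show "\<mu> * \<eta> \<in> units4" if "\<eta> \<in> units4" for \<eta> using that \<mu> units_mult by auto
  show "z * w \<in> int_span \<i>" if "z \<in> int_span \<i>" "w \<in> int_span \<i>" for z w
    using that by (rule mult)
qed (fact units4_subset int_span_add int_span_zero cmod_units(3) units_mult(5))+

section \<open>Triangle groups\<close>

context frame
begin

theorem discrete_reflection_lattice:
  fixes s :: complex and n\<^sub>1 n\<^sub>2 :: nat
  defines "q \<equiv> t + (of_real D * cnj s) *s e - of_real (D / 2 * (cmod s)\<^sup>2) *s p"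
  assumes lattice: "reflection_lattice R U I (unity_root n\<^sub>1) (unity_root n\<^sub>2) \<sigma>"
    and c: "herm c c = 1" and q: "creflection 2 c *v p = q" and n: "n\<^sub>1 > 0" "n\<^sub>2 > 0"
    and far: "\<And>\<eta> l. \<eta> \<in> U \<Longrightarrow> l \<in> R \<Longrightarrow> l - \<eta> + 1 \<in> I \<Longrightarrow> (\<eta>, l) \<noteq> (1, 0) \<Longrightarrow>
      8 \<le> D * (cmod ((1 - \<eta>) * s + (1 - unity_root n\<^sub>1) * l))\<^sup>2"
    and vertical: "8 \<le> D * \<sigma>"
  shows "discrete_subgroup_PU21
    (generate PU21 (PU21_class ` {creflection 2 c, creflection n\<^sub>1 (e + p), creflection n\<^sub>2 e}))"
proof -
  interpret reflection_lattice R U I "unity_root n\<^sub>1" "unity_root n\<^sub>2" \<sigma> by (rule lattice)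
  show ?thesis
  proof (rule discrete_reflection_group[OF c q[unfolded q_def] n heisenberg_lattice_one
        heisenberg_lattice_closed1 heisenberg_lattice_closed2 heisenberg_lattice_unit])
    fix \<eta> u \<tau> assume mem: "(\<eta>, u, \<tau>) \<in> heisenberg_lattice" and ne: "(\<eta>, u, \<tau>) \<noteq> (1, 0, 0)"
    obtain l k where l: "\<eta> \<in> U" "l \<in> R" "l - \<eta> + 1 \<in> I" "u = (1 - unity_root n\<^sub>1) * l" "\<tau> = \<sigma> * of_int k"
      using mem unfolding heisenberg_lattice_def by blast
    show "8 \<le> D * (cmod ((1 - \<eta>) * s + u))\<^sup>2 \<or> \<eta> = 1 \<and> u = 0 \<and> 8 \<le> D * \<bar>\<tau>\<bar>"
    proof (cases "(\<eta>, l) = (1, 0)")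
      case True
      then have "k \<noteq> 0" using ne l by auto
      then have "1 \<le> \<bar>real_of_int k\<bar>" by linarith
      have "0 \<le> D * \<sigma>" using vertical by linarith
      then have "0 \<le> \<sigma>" using D by (simp add: zero_le_mult_iff)
      have "D * \<sigma> * 1 \<le> D * \<sigma> * \<bar>real_of_int k\<bar>"
        using \<open>1 \<le> \<bar>real_of_int k\<bar>\<close> \<open>0 \<le> D * \<sigma>\<close> by (rule mult_left_mono)
      then show ?thesis using True l vertical \<open>0 \<le> \<sigma>\<close> by (simp add: abs_mult mult.assoc)
    next
      case False
      then show ?thesis using far l by blast
    qed
  qed
qed

end

text \<open>In half angles exp(i alpha) - 1 = 2 i sin(alpha/2) exp(i alpha/2), whose reciprocal has
  real part -1/2 for every alpha.\<close>

lemma base_ratio_exp: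
  assumes "sin (\<alpha> / 2) \<noteq> 0"
  shows "(exp (\<i> * of_real \<alpha>) - 1) * base_ratio (cot (\<alpha> / 2)) = 1"
proof -
  define S C where "S = sin (\<alpha> / 2)" and "C = cos (\<alpha> / 2)"
  have SC: "S * S + C * C = 1" "S \<noteq> 0"
    using sin_cos_squared_add[of "\<alpha> / 2"] assms by (simp_all add: S_def C_def power2_eq_square)
  have e: "cos \<alpha> = 1 - 2 * (S * S)" "sin \<alpha> = 2 * S * C"
    using cos_double_sin[of "\<alpha> / 2"] sin_double[of "\<alpha> / 2"]
    by (simp_all add: S_def C_def power2_eq_square)
  have E: "exp (\<i> * of_real \<alpha>) = Complex (cos \<alpha>) (sin \<alpha>)"
    by (simp add: cis_conv_exp[symmetric] complex_eq_iff)
  have cot: "cot (\<alpha> / 2) = C / S" by (simp add: cot_def S_def C_def)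
  show ?thesis
    unfolding E cot e using SC by (simp add: complex_eq_iff field_simps)
qed

text \<open>Builds the frame from the three polar vectors. The unit \<open>a\<close> rescales the
  second one; it is harmless because a reflection depends only on the line of its polar
  vector.\<close>

lemma discrete_three_reflections:
  assumes c: "herm c\<^sub>1 c\<^sub>1 = 1" "herm c\<^sub>2 c\<^sub>2 = 1" "herm c\<^sub>3 c\<^sub>3 = 1"
    and r: "cmod (herm c\<^sub>3 c\<^sub>2) = r" "cmod (herm c\<^sub>1 c\<^sub>3) = r" "cmod (herm c\<^sub>2 c\<^sub>1) = 1"
    and arg: "is_Arg (herm c\<^sub>3 c\<^sub>2 * herm c\<^sub>1 c\<^sub>3 * herm c\<^sub>2 c\<^sub>1) \<alpha>"
    and \<alpha>: "sin (\<alpha> / 2) \<noteq> 0" and n: "n\<^sub>1 > 0" "n\<^sub>2 > 0"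
    and lattice: "reflection_lattice R U I (unity_root n\<^sub>1) (unity_root n\<^sub>2) \<sigma>"
    and k: "4 \<le> k * r\<^sup>2"
    and far: "\<And>\<eta> l. \<eta> \<in> U \<Longrightarrow> l \<in> R \<Longrightarrow> l - \<eta> + 1 \<in> I \<Longrightarrow> (\<eta>, l) \<noteq> (1, 0) \<Longrightarrow>
      k * (cmod (base_ratio (cot (\<alpha> / 2))))\<^sup>2 \<le> (cmod ((1 - \<eta>) * base_ratio (cot (\<alpha> / 2)) + (1 - unity_root n\<^sub>1) * l))\<^sup>2"
    and vertical: "k * (cmod (base_ratio (cot (\<alpha> / 2))))\<^sup>2 \<le> \<sigma>"
  shows "\<exists>a. cmod a = 1 \<and> discrete_subgroup_PU21 (generate PU21
    (PU21_class ` {creflection 2 c\<^sub>3, creflection n\<^sub>1 c\<^sub>1, creflection n\<^sub>2 (a *s c\<^sub>2)}))"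
proof (intro exI conjI)
  let ?a = "herm c\<^sub>1 c\<^sub>2"
  show a1: "cmod ?a = 1" using r(3) by (simp add: cmod_herm_commute)
  have a: "?a * herm c\<^sub>2 c\<^sub>1 = 1" "herm c\<^sub>2 c\<^sub>1 * ?a = 1"
    using a1 complex_norm_square[of ?a] by (simp_all add: herm_cnj mult.commute)
  \<comment> \<open>This scaling gives \<open>herm c\<^sub>1 e = 1\<close>, so that
    \<open>c\<^sub>1 - e\<close> is null and orthogonal to \<open>e\<close>.\<close>
  define e where "e = ?a *s c\<^sub>2"
  define p where "p = c\<^sub>1 - e"
  define A B where "A = herm c\<^sub>1 c\<^sub>3" and "B = herm e c\<^sub>3"
  have ee: "herm e e = 1" "herm c\<^sub>1 e = 1" "herm e c\<^sub>1 = 1"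
    using a by (simp_all add: e_def herm_scale herm_cnj c)
  have pp: "herm p p = 0" "herm p e = 0" "herm e p = 0" "herm p c\<^sub>3 = A - B"
    by (simp_all add: p_def herm_diff ee c A_def B_def)
  have swap: "herm c\<^sub>3 e = cnj B" "herm c\<^sub>3 p = cnj (A - B)"
    by (simp add: B_def herm_cnj) (simp only: herm_cnj flip: pp(4))
  have AB: "cmod A = r" "cmod B = r"
    using r a1 by (simp_all add: A_def B_def e_def herm_scale norm_mult cmod_herm_commute[of c\<^sub>2 c\<^sub>3])
  have "0 < k * r\<^sup>2" using k by linarith
  then have r0: "r \<noteq> 0" by auto
  have BB: "B * cnj B = of_real (r\<^sup>2)" using complex_norm_square[of B] AB by simp
  have "herm c\<^sub>3 c\<^sub>2 * herm c\<^sub>1 c\<^sub>3 * herm c\<^sub>2 c\<^sub>1 = A * cnj B"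
    by (simp add: A_def B_def e_def herm_scale herm_cnj)
  moreover have "cmod (A * cnj B) = r\<^sup>2" using AB by (simp add: norm_mult power2_eq_square)
  ultimately have "A * cnj B = of_real (r\<^sup>2) * exp (\<i> * of_real \<alpha>)"
    using arg by (simp add: is_Arg_def)
  then have "A * (B * cnj B) = of_real (r\<^sup>2) * (exp (\<i> * of_real \<alpha>) * B)" by (simp add: mult_ac)
  then have A: "A = exp (\<i> * of_real \<alpha>) * B" using r0 by (simp add: BB mult_ac)
  define s where "s = base_ratio (cot (\<alpha> / 2))"
  have "B \<noteq> 0" using AB r0 by auto
  \<comment> \<open>So s = B/(A - B). As B is nonzero, this also gives A different from B, hence
    iota_3 does not fix \<open>p\<close>.\<close>
  have sB: "(A - B) * s = B"
    using base_ratio_exp[OF \<alpha>] by (simp add: A s_def algebra_simps)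
  then have "A - B \<noteq> 0" using \<open>B \<noteq> 0\<close> by auto
  define D where "D = 2 * (cmod (A - B))\<^sup>2"
  have D0: "0 < D" using \<open>A - B \<noteq> 0\<close> by (simp add: D_def)
  have Dc: "of_real D = 2 * (A - B) * cnj (A - B)"
    using complex_norm_square[of "A - B"] by (simp add: D_def mult.assoc)
  \<comment> \<open>This ties the scale to m: 8 <= D |w|^2 becomes 4 |s|^2 <= r^2 |w|^2.\<close>
  have Ds: "D * (cmod s)\<^sup>2 = 2 * r\<^sup>2"
    using arg_cong[OF sB, of "\<lambda>z. 2 * (cmod z)\<^sup>2"] AB by (simp add: D_def norm_mult power_mult_distrib)
  define q where "q = creflection 2 c\<^sub>3 *v p"
  have q: "q = - p + (2 * (A - B)) *s c\<^sub>3"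
    by (simp add: q_def refl_apply[OF c(3)] pp)
  have qq: "herm q q = 0" using refl_U21[OF c(3), of 2] pp(1) by (simp add: q_def)
  have "of_real D * s = 2 * cnj (A - B) * ((A - B) * s)" unfolding Dc by (simp only: mult_ac)
  then have Ds': "of_real D * s = 2 * cnj (A - B) * B" by (simp only: sB)
  have eq: "herm e q = of_real D * s" "herm p q = of_real D"
    unfolding Ds' by (simp_all only: q herm_add herm_minus herm_scale pp Dc B_def[symmetric])
      (simp_all add: algebra_simps)
  then have eq': "herm q e = of_real D * cnj s" "herm q p = of_real D"
    using herm_cnj[of e q] herm_cnj[of p q] by simp_all
  have ss: "of_real (D / 2 * (cmod s)\<^sup>2) = of_real (D / 2) * (s * cnj s)"
    unfolding complex_norm_square[symmetric] by simp
  \<comment> \<open>Solved from the form that \<open>q\<close> must have in the frame: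
    \<open>q\<close> over \<open>s\<close>, and \<open>t\<close> over the origin at the same
    height.\<close>
  define t where "t = q - (of_real D * cnj s) *s e + of_real (D / 2 * (cmod s)\<^sup>2) *s p"
  interpret frame p e t D
  proof
    show "herm t t = 0" unfolding t_def ss
      by (simp add: herm_add herm_diff herm_scale qq eq eq' pp ee algebra_simps)
    show "herm t e = 0" "herm p t = of_real D" unfolding t_def ss
      by (simp_all add: herm_add herm_diff herm_scale qq eq eq' pp ee)
  qed (simp_all add: D0 pp ee)
  have "D * (k * (cmod s)\<^sup>2) = 2 * (k * r\<^sup>2)" using Ds by (simp add: mult.left_commute)
  then have 8: "8 \<le> D * (k * (cmod s)\<^sup>2)" using k by linarith
  have "discrete_subgroup_PU21 (generate PU21 (PU21_class ` {creflection 2 c\<^sub>3, creflection n\<^sub>1 (e + p), creflection n\<^sub>2 e}))"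
  proof (rule discrete_reflection_lattice[OF lattice c(3) _ n])
    show "creflection 2 c\<^sub>3 *v p = t + (of_real D * cnj s) *s e - of_real (D / 2 * (cmod s)\<^sup>2) *s p"
      by (simp add: t_def flip: q_def)
    have "D * (k * (cmod s)\<^sup>2) \<le> D * \<sigma>" using vertical D0 by (simp add: s_def)
    with 8 show "8 \<le> D * \<sigma>" by linarith
    fix \<eta> l assume "\<eta> \<in> U" "l \<in> R" "l - \<eta> + 1 \<in> I" "(\<eta>, l) \<noteq> (1, 0)"
    then have "D * (k * (cmod s)\<^sup>2) \<le> D * (cmod ((1 - \<eta>) * s + (1 - unity_root n\<^sub>1) * l))\<^sup>2"
      using far D0 by (simp add: s_def)
    with 8 show "8 \<le> D * (cmod ((1 - \<eta>) * s + (1 - unity_root n\<^sub>1) * l))\<^sup>2" by linarith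
  qed
  then show "discrete_subgroup_PU21 (generate PU21
    (PU21_class ` {creflection 2 c\<^sub>3, creflection n\<^sub>1 c\<^sub>1, creflection n\<^sub>2 (?a *s c\<^sub>2)}))"
    by (simp add: p_def flip: e_def)
qed

lemma geodesic_of_scale: "a \<noteq> 0 \<Longrightarrow> geodesic_of (a *s c) = geodesic_of c"
  by (simp add: geodesic_of_def herm_scale)

text \<open>The condition sin(alpha/2) nonzero says that cot(alpha/2) is defined; at alpha = 0 and
  alpha = 2 pi the total function \<open>cot\<close> has the value 0 and would satisfy the
  bound.\<close>

theorem proposition1p2:
  fixes m :: "3 \<Rightarrow> real" and n :: "3 \<Rightarrow> nat" and C :: "3 \<Rightarrow> (complex^3) set set"
    and \<alpha> K :: real
  assumes "ultra_parallel_triangle m C"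
    and "angular_invariant C \<alpha>"
    and "m 1 = m 2" and "m 3 = 0"
    and "n 1 \<le> n 2" and "n 3 = 2"
    and "(n 1, n 2, K) \<in> {(3, 3, 1 / sqrt 3), (2, 3, 2 * sqrt 2 - sqrt 3),
           (2, 6, (4 - sqrt 5) / sqrt 3), (3, 6, 1 / sqrt 3), (2, 4, 1), (4, 4, 2 - sqrt 3)}"
    and "cosh (m 1 / 2) \<ge> 1 / sin (pi / n 2)"
    and "sin (\<alpha> / 2) \<noteq> 0" and "\<bar>cot (\<alpha> / 2)\<bar> \<le> K"
  shows "discrete_subgroup_PU21 (triangle_group n C)"
proof -
  obtain c where c: "\<And>k. normalised_polar_vector (c k) (C k)"
    and arg: "is_Arg (\<Prod>k\<in>UNIV. herm (c (k - 1)) (c (k + 1))) \<alpha>"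
    using assms(2) unfolding angular_invariant_def by blast
  have cc: "herm (c k) (c k) = 1" and C: "C k = geodesic_of (c k)" and pc: "polar_vector (c k) (C k)" for k
    using c[of k] by (auto simp: normalised_polar_vector_def polar_vector_def)
  have s: "(1::3) - 1 = 3" "(2::3) - 1 = 1" "(3::3) - 1 = 2"
    "(1::3) + 1 = 2" "(2::3) + 1 = 3" "(3::3) + 1 = 1" by simp_all
  have P: "prod f UNIV = f 1 * f 2 * f 3" for f :: "3 \<Rightarrow> complex"
    unfolding UNIV_3 by (simp add: ac_simps)
  \<comment> \<open>This covers the ideal pair as well: \<open>m 3 = 0\<close> gives modulus cosh 0
    = 1.\<close>
  have dist: "cmod (herm (c (k - 1)) (c (k + 1))) = cosh (m k / 2)" if "k - 1 \<noteq> k + 1" for k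
  proof -
    have "disjoint_in_plane (C (k - 1)) (C (k + 1))" "geodesic_dist (C (k - 1)) (C (k + 1)) = m k"
      using assms(1) that unfolding ultra_parallel_triangle_def by blast+
    then show ?thesis
      using cosh_geodesic_dist(1)[OF cc cc disjoint_imp_cmod_herm_ge_1[OF cc cc]] unfolding C by metis
  qed
  define r where "r = cosh (m 1 / 2)"
  have r: "cmod (herm (c 3) (c 2)) = r" "cmod (herm (c 1) (c 3)) = r" "cmod (herm (c 2) (c 1)) = 1"
    using dist[of 1] dist[of 2] dist[of 3] assms(3,4) unfolding s r_def by simp_all
  have arg': "is_Arg (herm (c 3) (c 2) * herm (c 1) (c 3) * herm (c 2) (c 1)) \<alpha>"
    using arg unfolding P s .
  define x where "x = cot (\<alpha> / 2)"
  have n0: "n 1 > 0" "n 2 > 0" using assms(7) by auto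
  have "\<exists>a. cmod a = 1 \<and> discrete_subgroup_PU21 (generate PU21
    (PU21_class ` {creflection 2 (c 3), creflection (n 1) (c 1), creflection (n 2) (a *s c 2)}))"
  proof -
    note main = discrete_three_reflections[OF cc cc cc r arg' assms(9) n0, folded x_def]
    have xK: "\<bar>x\<bar> \<le> K" using assms(10) by (simp add: x_def)
    have rb: "1 / sin (pi / n 2) \<le> r" using assms(8) by (simp add: r_def)
    \<comment> \<open>The factors 3, 2 and 1 in \<open>r3\<close>, \<open>r4\<close> and
      \<open>r6\<close> are 4 sin(pi/n_2)^2.\<close>
    have r3: "4 \<le> 3 * r\<^sup>2" if "n 2 = 3"
    proof -
      have "(1 / sin (pi / n 2))\<^sup>2 \<le> r\<^sup>2" using rb that by (intro power_mono) (simp_all add: sin_60)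
      then show ?thesis by (simp add: that sin_60 power_divide)
    qed
    have r4: "4 \<le> 2 * r\<^sup>2" if "n 2 = 4"
    proof -
      have "(1 / sin (pi / n 2))\<^sup>2 \<le> r\<^sup>2" using rb that by (intro power_mono) (simp_all add: sin_45)
      then show ?thesis by (simp add: that sin_45 power_divide)
    qed
    have r6: "4 \<le> 1 * r\<^sup>2" if "n 2 = 6"
    proof -
      have "(1 / sin (pi / n 2))\<^sup>2 \<le> r\<^sup>2" using rb that by (intro power_mono) (simp_all add: sin_30)
      then show ?thesis by (simp add: that sin_30 power_divide)
    qed
    have "1 / sqrt 3 \<le> 11 / 10" "2 * sqrt 2 - sqrt 3 \<le> 11 / 10" "(4 - sqrt 5) / sqrt 3 \<le> 11 / 10"
      "2 - sqrt 3 \<le> 11 / 10"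
      using sqrt2_bounds sqrt3_bounds sqrt5_bound by (simp_all add: divide_le_eq)
    then have "K \<le> 11 / 10" using assms(7) by auto
    then have "\<bar>x\<bar> * \<bar>x\<bar> \<le> 11 / 10 * (11 / 10)" using xK by (intro mult_mono) auto
    \<comment> \<open>One bound serves all vertical conditions: 3 * 9/16 = 27/16 lies just below
      sqrt 3.\<close>
    then have base_ratio_le: "(cmod (base_ratio x))\<^sup>2 \<le> 9 / 16" unfolding cmod_base_ratio by (simp add: power2_eq_square)
    consider "n 1 = 3" "n 2 = 3" "K = 1 / sqrt 3" | "n 1 = 2" "n 2 = 3" "K = 2 * sqrt 2 - sqrt 3"
      | "n 1 = 2" "n 2 = 6" "K = (4 - sqrt 5) / sqrt 3" | "n 1 = 3" "n 2 = 6" "K = 1 / sqrt 3"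
      | "n 1 = 2" "n 2 = 4" "K = 1" | "n 1 = 4" "n 2 = 4" "K = 2 - sqrt 3"
      using assms(7) by auto
    then show ?thesis
    proof cases
      case 1
      show ?thesis
      proof (rule main)
        show "reflection_lattice (int_span omega) units3 (int_span omega) (unity_root (n 1)) (unity_root (n 2)) (sqrt 3)"
          unfolding 1 roots by (rule reflection_lattice_eisenstein) simp
        show "4 \<le> 3 * r\<^sup>2" using r3 1 by blast
        show "3 * (cmod (base_ratio x))\<^sup>2 \<le> sqrt 3" using base_ratio_le sqrt3_bounds by simp
        show "3 * (cmod (base_ratio x))\<^sup>2 \<le> (cmod ((1 - \<eta>) * base_ratio x + (1 - unity_root (n 1)) * l))\<^sup>2"
          if "\<eta> \<in> units3" "l \<in> int_span omega" "l - \<eta> + 1 \<in> int_span omega" "(\<eta>, l) \<noteq> (1, 0)" for \<eta> l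
          unfolding 1 roots using displacement_33[OF xK[unfolded 1]] that by simp
      qed
    next
      case 2
      show ?thesis
      proof (rule main)
        show "reflection_lattice (int_span omega) units6 eisenstein_ideal (unity_root (n 1)) (unity_root (n 2)) (sqrt 3)"
          unfolding 2 roots by (rule reflection_lattice_eisenstein_ideal)
        show "4 \<le> 3 * r\<^sup>2" using r3 2 by blast
        show "3 * (cmod (base_ratio x))\<^sup>2 \<le> sqrt 3" using base_ratio_le sqrt3_bounds by simp
        show "3 * (cmod (base_ratio x))\<^sup>2 \<le> (cmod ((1 - \<eta>) * base_ratio x + (1 - unity_root (n 1)) * l))\<^sup>2"
          if "\<eta> \<in> units6" "l \<in> int_span omega" "l - \<eta> + 1 \<in> eisenstein_ideal" "(\<eta>, l) \<noteq> (1, 0)" for \<eta> l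
          unfolding 2 roots using displacement_23[OF xK[unfolded 2]] that by simp
      qed
    next
      case 3
      show ?thesis
      proof (rule main)
        show "reflection_lattice (int_span omega) units6 (int_span omega) (unity_root (n 1)) (unity_root (n 2)) (sqrt 3)"
          unfolding 3 roots by (rule reflection_lattice_eisenstein) simp
        show "4 \<le> 1 * r\<^sup>2" using r6 3 by blast
        show "1 * (cmod (base_ratio x))\<^sup>2 \<le> sqrt 3" using base_ratio_le sqrt3_bounds by simp
        show "1 * (cmod (base_ratio x))\<^sup>2 \<le> (cmod ((1 - \<eta>) * base_ratio x + (1 - unity_root (n 1)) * l))\<^sup>2"
          if "\<eta> \<in> units6" "l \<in> int_span omega" "l - \<eta> + 1 \<in> int_span omega" "(\<eta>, l) \<noteq> (1, 0)" for \<eta> l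
          unfolding 3 roots using displacement_26[OF xK[unfolded 3]] that by simp
      qed
    next
      case 4
      show ?thesis
      proof (rule main)
        show "reflection_lattice (int_span omega) units6 (int_span omega) (unity_root (n 1)) (unity_root (n 2)) (sqrt 3)"
          unfolding 4 roots by (rule reflection_lattice_eisenstein) simp
        show "4 \<le> 1 * r\<^sup>2" using r6 4 by blast
        show "1 * (cmod (base_ratio x))\<^sup>2 \<le> sqrt 3" using base_ratio_le sqrt3_bounds by simp
        show "1 * (cmod (base_ratio x))\<^sup>2 \<le> (cmod ((1 - \<eta>) * base_ratio x + (1 - unity_root (n 1)) * l))\<^sup>2"
          if "\<eta> \<in> units6" "l \<in> int_span omega" "l - \<eta> + 1 \<in> int_span omega" "(\<eta>, l) \<noteq> (1, 0)" for \<eta> l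
          unfolding 4 roots using displacement_36[OF xK[unfolded 4]] that by simp
      qed
    next
      case 5
      show ?thesis
      proof (rule main)
        show "reflection_lattice (int_span \<i>) units4 (int_span \<i>) (unity_root (n 1)) (unity_root (n 2)) 2"
          unfolding 5 roots by (rule reflection_lattice_gaussian) simp
        show "4 \<le> 2 * r\<^sup>2" using r4 5 by blast
        show "2 * (cmod (base_ratio x))\<^sup>2 \<le> 2" using base_ratio_le sqrt3_bounds by simp
        show "2 * (cmod (base_ratio x))\<^sup>2 \<le> (cmod ((1 - \<eta>) * base_ratio x + (1 - unity_root (n 1)) * l))\<^sup>2"
          if "\<eta> \<in> units4" "l \<in> int_span \<i>" "l - \<eta> + 1 \<in> int_span \<i>" "(\<eta>, l) \<noteq> (1, 0)" for \<eta> l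
          unfolding 5 roots using displacement_24[OF xK[unfolded 5]] that by simp
      qed
    next
      case 6
      show ?thesis
      proof (rule main)
        show "reflection_lattice (int_span \<i>) units4 (int_span \<i>) (unity_root (n 1)) (unity_root (n 2)) 2"
          unfolding 6 roots by (rule reflection_lattice_gaussian) simp
        show "4 \<le> 2 * r\<^sup>2" using r4 6 by blast
        show "2 * (cmod (base_ratio x))\<^sup>2 \<le> 2" using base_ratio_le sqrt3_bounds by simp
        show "2 * (cmod (base_ratio x))\<^sup>2 \<le> (cmod ((1 - \<eta>) * base_ratio x + (1 - unity_root (n 1)) * l))\<^sup>2"
          if "\<eta> \<in> units4" "l \<in> int_span \<i>" "l - \<eta> + 1 \<in> int_span \<i>" "(\<eta>, l) \<noteq> (1, 0)" for \<eta> l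
          unfolding 6 roots using displacement_44[OF xK[unfolded 6]] that by simp
      qed
    qed
  qed
  then obtain a where a: "cmod a = 1" and discrete: "discrete_subgroup_PU21 (generate PU21
    (PU21_class ` {creflection 2 (c 3), creflection (n 1) (c 1), creflection (n 2) (a *s c 2)}))" by blast
  have "a * cnj a = 1" "a \<noteq> 0" using a by (auto simp flip: complex_norm_square)
  then have "herm (a *s c 2) (a *s c 2) = 1" "geodesic_of (a *s c 2) = C 2"
    using C[of 2] cc[of 2] by (simp_all add: geodesic_of_scale herm_scale mult.commute)
  then have "polar_vector (a *s c 2) (C 2)" by (simp add: polar_vector_def)
  then have "minimal_reflection (n 2) (C 2) = PU21_class (creflection (n 2) (a *s c 2))"
    by (rule minimal_reflection_eq)
  moreover have "minimal_reflection (n 1) (C 1) = PU21_class (creflection (n 1) (c 1))"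
    "minimal_reflection (n 3) (C 3) = PU21_class (creflection 2 (c 3))"
    using minimal_reflection_eq[OF pc[of 1]] minimal_reflection_eq[OF pc[of 3]] assms(6) by simp_all
  ultimately have "(\<lambda>k. minimal_reflection (n k) (C k)) ` UNIV
    = PU21_class ` {creflection 2 (c 3), creflection (n 1) (c 1), creflection (n 2) (a *s c 2)}"
    by (simp add: UNIV_3 insert_commute)
  with discrete show ?thesis unfolding triangle_group_def by simp
qed

end
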